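(* Let $K$ be a field of characteristic zero, $x=(x_1,\dots,x_n)$, $y=(y_1,\dots,y_n)$, and let $F=(F_1,\dots,F_n)\in K[x]^n$ be an arbitrary polynomial map. Let $g\in K[x]$ be square-free. Then the following are equivalent: 1) $g \mid \det \mathcal{J} F$; 2) for every irreducible $\tilde g\in K[x]$ with $\tilde g\mid g$, there exists an irreducible polynomial $\tilde w\in K[y]$ such that $\tilde g^2 \mid \tilde w(F)$; 3) $g^2\mid w(F)$ for some square-free polynomial $w\in K[y]$.
   Context: $\mathcal{J}F$ denotes the Jacobian matrix $(\partial F_i/\partial x_j)_{i,j}$. For $w\in K[y]$, $w(F)$ denotes the polynomial obtained by substituting $y_i=F_i$. A polynomial is square-free if it is not divisible by the square of a nonconstant polynomial. *)

theory Defs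
  imports "HOL-Analysis.Analysis" "HOL-Library.Poly_Mapping" "HOL-Computational_Algebra.Squarefree"
begin

text \<open>Multivariate polynomials over 'a in the variables indexed by the finite type 'v:
  a polynomial is a finitely supported map from monomials (exponent vectors 'v =>0 nat)
  to coefficients. The number of variables n is CARD('v).\<close>

type_synonym ('v, 'a) mpoly = "('v \<Rightarrow>\<^sub>0 nat) \<Rightarrow>\<^sub>0 'a"

definition mconst :: "'a::zero \<Rightarrow> ('v, 'a) mpoly" where
  "mconst c = Poly_Mapping.single 0 c"

definition mpderiv :: "'v \<Rightarrow> ('v, 'a::comm_ring_1) mpoly \<Rightarrow> ('v, 'a) mpoly" where
  "mpderiv v p = (\<Sum>m\<in>Poly_Mapping.keys p.
      Poly_Mapping.single (m - Poly_Mapping.single v 1) (of_nat (Poly_Mapping.lookup m v) * Poly_Mapping.lookup p m))"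

definition msubst :: "('v::finite, 'a::comm_ring_1) mpoly \<Rightarrow> ('v \<Rightarrow> ('u, 'a) mpoly) \<Rightarrow> ('u, 'a) mpoly" where
  "msubst w F = (\<Sum>m\<in>Poly_Mapping.keys w. mconst (Poly_Mapping.lookup w m) * (\<Prod>v\<in>UNIV. F v ^ Poly_Mapping.lookup m v))"

definition jacobian :: "('v::finite \<Rightarrow> ('v, 'a::comm_ring_1) mpoly) \<Rightarrow> ('v, 'a) mpoly ^'v ^'v" where
  "jacobian F = (\<chi> i j. mpderiv j (F i))"

end

theory Submission
  imports Defs
begin

text \<open>Since irreducible polynomials are prime, everything reduces to one irreducible \<open>g\<close> and the
  prime ideal \<open>P\<close> of relations \<open>w\<close> with \<open>g dvd w(F)\<close>. Differentiating \<open>w(F) = g h\<close> gives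
  \<open>(\<nabla>w)(F) \<cdot> JF \<equiv> h \<nabla>g\<close> modulo \<open>g\<close>.

  If \<open>det JF \<not>\<equiv> 0\<close>, all gradients \<open>(\<nabla>w)(F)\<close> with \<open>w\<close> in \<open>P\<close> are thus proportional modulo \<open>g\<close>. For a
  relation of minimal degree with \<open>\<partial>/\<partial>v\<close> outside \<open>P\<close>, this excludes relations without \<open>v\<close>. A square-free
  \<open>w\<close> with \<open>g\<^sup>2 dvd w(F)\<close> would have \<open>w\<close> and \<open>\<partial>w/\<partial>v\<close> in \<open>P\<close>, hence also a nonzero combination of them
  without \<open>v\<close>, a contradiction.

  If \<open>det JF \<equiv> 0\<close>, let \<open>T\<close> be a maximal set of variables on which \<open>P\<close> has no relation; it is proper by a
  dimension count. If it omits a single variable, the gradients of \<open>g\<close> and of the remaining \<open>F\<^sub>i\<close> form a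
  basis modulo \<open>g\<close>, and \<open>det JF \<equiv> 0\<close> forces \<open>h \<equiv> 0\<close> for every relation. If it omits two variables \<open>s\<close> and
  \<open>t\<close>, relations \<open>p\<close> and \<open>q\<close> over \<open>T\<close> and \<open>s\<close>, resp. \<open>T\<close> and \<open>t\<close>, combine to \<open>s\<^sup>a p\<^sup>2 + t\<^sup>b q\<^sup>2\<close>, which is
  irreducible up to a factor in the variables of \<open>T\<close> when its degrees in \<open>s\<close> and \<open>t\<close> are coprime.\<close>

section \<open>Evaluation homomorphisms and subrings generated by variables\<close>

definition is_hom :: "('a::comm_ring_1 \<Rightarrow> 'b::comm_ring_1) \<Rightarrow> bool" where
  "is_hom f \<longleftrightarrow> f 1 = 1 \<and> (\<forall>x y. f (x + y) = f x + f y) \<and> (\<forall>x y. f (x * y) = f x * f y)"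

lemma is_homI:
  assumes "f 1 = 1" "\<And>x y. f (x + y) = f x + f y" "\<And>x y. f (x * y) = f x * f y"
  shows "is_hom f"
  using assms by (simp add: is_hom_def)

context
  fixes f :: "'a::comm_ring_1 \<Rightarrow> 'b::comm_ring_1"
  assumes f: "is_hom f"
begin

lemma hom_add: "f (x + y) = f x + f y" and hom_mult: "f (x * y) = f x * f y" and hom_1: "f 1 = 1"
  using f by (simp_all add: is_hom_def)

lemma hom_0: "f 0 = 0"
  using hom_add[of 0 0] by simp

lemma hom_uminus: "f (- x) = - f x"
  using hom_add[of x "- x"] by (simp add: hom_0 eq_neg_iff_add_eq_0 add.commute)

lemma hom_diff: "f (x - y) = f x - f y"
  using hom_add[of x "- y"] by (simp add: hom_uminus)

lemma hom_sum: "f (sum g A) = (\<Sum>i\<in>A. f (g i))"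
  by (induction A rule: infinite_finite_induct) (simp_all add: hom_0 hom_add)

lemma hom_prod: "f (prod g A) = (\<Prod>i\<in>A. f (g i))"
  by (induction A rule: infinite_finite_induct) (simp_all add: hom_1 hom_mult)

lemma hom_power: "f (x ^ n) = f x ^ n"
  by (induction n) (simp_all add: hom_1 hom_mult)

lemma hom_of_int: "f (of_int k) = of_int k"
proof -
  have "f (of_nat n) = of_nat n" for n
    by (induction n) (simp_all add: hom_0 hom_1 hom_add)
  then show ?thesis
    by (cases k rule: int_cases2) (simp_all add: hom_uminus)
qed

lemma hom_dvd: "a dvd b \<Longrightarrow> f a dvd f b"
  by (auto simp: dvd_def hom_mult)

lemma hom_det:
  fixes A :: "'a ^ 'n::finite ^ 'n"
  shows "f (det A) = det (\<chi> i j. f (A $ i $ j))"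
  by (simp add: det_def hom_sum hom_mult hom_of_int hom_prod)

end

lemma is_hom_comp: "is_hom f \<Longrightarrow> is_hom g \<Longrightarrow> is_hom (\<lambda>x. g (f x))"
  by (simp add: is_hom_def)

definition mvar :: "'v \<Rightarrow> ('v, 'a::zero_neq_one) mpoly" where
  "mvar v = Poly_Mapping.single (Poly_Mapping.single v 1) 1"

lemma is_hom_mconst: "is_hom (mconst :: 'a::comm_ring_1 \<Rightarrow> ('v, 'a) mpoly)"
  by (rule is_homI) (simp_all add: mconst_def single_add mult_single)

lemmas mconst_hom = hom_0[OF is_hom_mconst] hom_1[OF is_hom_mconst] hom_add[OF is_hom_mconst]
  hom_mult[OF is_hom_mconst] hom_uminus[OF is_hom_mconst] hom_diff[OF is_hom_mconst]

lemma mconst_eq_0_iff [simp]: "mconst c = 0 \<longleftrightarrow> c = 0"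
  by (metis lookup_single_eq lookup_zero mconst_def single_zero)

lemma mconst_1 [simp]: "mconst 1 = 1"
  by (simp add: mconst_def)

lemma mconst_0 [simp]: "mconst 0 = 0"
  by (simp add: mconst_def)

lemma is_hom_const_poly: "is_hom (\<lambda>c. [:mconst c:] :: ('v, 'a::comm_ring_1) mpoly poly)"
  by (rule is_homI) (simp_all add: mconst_hom one_pCons mult.commute)

lemma poly_mapping_eq_sum_single:
  fixes p :: "'k \<Rightarrow>\<^sub>0 'a::comm_monoid_add"
  shows "p = (\<Sum>m\<in>Poly_Mapping.keys p. Poly_Mapping.single m (Poly_Mapping.lookup p m))"
  by (rule poly_mapping_eqI)
     (auto simp: lookup_sum lookup_single "when_def" sum.delta' in_keys_iff)

lemma mvar_power: "(mvar v :: ('v, 'a::comm_ring_1) mpoly) ^ k = Poly_Mapping.single (Poly_Mapping.single v k) 1"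
  by (induction k) (simp_all add: mvar_def mult_single single_add[symmetric])

lemma prod_single_1:
  "finite A \<Longrightarrow> (\<Prod>i\<in>A. Poly_Mapping.single (h i) (1::'a::comm_ring_1)) = Poly_Mapping.single (\<Sum>i\<in>A. h i) 1"
  for h :: "'i \<Rightarrow> ('v \<Rightarrow>\<^sub>0 nat)"
  by (induction A rule: finite_induct) (simp_all add: mult_single)

lemma monomial_eq_prod:
  fixes m :: "'v::finite \<Rightarrow>\<^sub>0 nat"
  shows "Poly_Mapping.single m (c::'a::comm_ring_1) = mconst c * (\<Prod>v\<in>UNIV. mvar v ^ Poly_Mapping.lookup m v)"
proof -
  have "m = (\<Sum>v\<in>UNIV. Poly_Mapping.single v (Poly_Mapping.lookup m v))"
    by (rule poly_mapping_eqI)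
       (auto simp: lookup_sum lookup_single "when_def" sum.delta')
  then have "Poly_Mapping.single m c = Poly_Mapping.single (\<Sum>v\<in>UNIV. Poly_Mapping.single v (Poly_Mapping.lookup m v)) c"
    by (rule arg_cong)
  then show ?thesis
    by (simp add: mvar_power prod_single_1 mconst_def mult_single)
qed

lemma mpoly_induct [case_names const var add mult]:
  fixes p :: "('v::finite, 'a::comm_ring_1) mpoly"
  assumes "\<And>c. P (mconst c)" "\<And>v. P (mvar v)" "\<And>p q. P p \<Longrightarrow> P q \<Longrightarrow> P (p + q)"
    "\<And>p q. P p \<Longrightarrow> P q \<Longrightarrow> P (p * q)"
  shows "P p"
proof -
  have P01: "P 0" "P 1"
    using assms(1)[of 0] assms(1)[of 1] by simp_all
  have pow: "P (q ^ k)" if "P q" for q k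
    by (induction k) (simp_all add: assms P01 that)
  have prod: "P (prod h A)" if "\<And>i. P (h i)" for h :: "'v \<Rightarrow> _" and A
    by (induction A rule: infinite_finite_induct) (simp_all add: assms P01 that)
  have single: "P (Poly_Mapping.single m c)" for m c
    unfolding monomial_eq_prod by (intro assms prod pow)
  have "P (\<Sum>m\<in>A. Poly_Mapping.single m (c m))" for c and A
    by (induction A rule: infinite_finite_induct) (simp_all add: assms single P01)
  from this[of "Poly_Mapping.lookup p" "Poly_Mapping.keys p"] show ?thesis
    by (simp flip: poly_mapping_eq_sum_single)
qed

text \<open>The target ring and the coefficient map \<open>\<kappa>\<close> stay general so that one
  construction serves substitution, weighted gradings and the view of a polynomial as univariate in
  a chosen variable.\<close>

definition ev :: "('a::comm_ring_1 \<Rightarrow> 'b::comm_ring_1) \<Rightarrow> ('v::finite \<Rightarrow> 'b) \<Rightarrow> ('v, 'a) mpoly \<Rightarrow> 'b" where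
  "ev \<kappa> h p = (\<Sum>m\<in>Poly_Mapping.keys p. \<kappa> (Poly_Mapping.lookup p m) * (\<Prod>v\<in>UNIV. h v ^ Poly_Mapping.lookup m v))"

lemma msubst_eq_ev: "msubst w F = ev mconst F w"
  by (simp add: msubst_def ev_def)

context
  fixes \<kappa> :: "'a::comm_ring_1 \<Rightarrow> 'b::comm_ring_1" and h :: "'v::finite \<Rightarrow> 'b"
  assumes k: "is_hom \<kappa>"
begin

lemma ev_superset:
  assumes "finite A" "Poly_Mapping.keys p \<subseteq> A"
  shows "ev \<kappa> h p = (\<Sum>m\<in>A. \<kappa> (Poly_Mapping.lookup p m) * (\<Prod>v\<in>UNIV. h v ^ Poly_Mapping.lookup m v))"
  unfolding ev_def using assms by (intro sum.mono_neutral_left) (auto simp: in_keys_iff hom_0[OF k])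

lemma ev_add: "ev \<kappa> h (p + q) = ev \<kappa> h p + ev \<kappa> h q"
  using Poly_Mapping.keys_add[of p q]
  by (subst (1 2 3) ev_superset[of "Poly_Mapping.keys p \<union> Poly_Mapping.keys q"])
     (auto simp: lookup_add hom_add[OF k] algebra_simps sum.distrib)

lemma ev_sum: "ev \<kappa> h (sum g A) = (\<Sum>i\<in>A. ev \<kappa> h (g i))"
proof (induction A rule: infinite_finite_induct)
qed (simp_all add: ev_add, simp_all add: ev_def)

lemma ev_single: "ev \<kappa> h (Poly_Mapping.single m c) = \<kappa> c * (\<Prod>v\<in>UNIV. h v ^ Poly_Mapping.lookup m v)"
  by (simp add: ev_def hom_0[OF k])

lemma ev_mconst: "ev \<kappa> h (mconst c) = \<kappa> c"
  by (simp add: mconst_def ev_single)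

lemma ev_mvar: "ev \<kappa> h (mvar v) = h v"
proof -
  have "(\<Prod>u\<in>UNIV. h u ^ Poly_Mapping.lookup (Poly_Mapping.single v 1) u) = (\<Prod>u\<in>UNIV. if u = v then h u else 1)"
    by (intro prod.cong) (auto simp: lookup_single "when_def")
  then show ?thesis
    by (simp add: mvar_def ev_single hom_1[OF k])
qed

lemma ev_mult: "ev \<kappa> h (p * q) = ev \<kappa> h p * ev \<kappa> h q"
proof -
  have single: "ev \<kappa> h (Poly_Mapping.single m c * Poly_Mapping.single m' c') =
      ev \<kappa> h (Poly_Mapping.single m c) * ev \<kappa> h (Poly_Mapping.single m' c')" for m c m' c'
    by (simp add: mult_single ev_single hom_mult[OF k] lookup_add power_add prod.distrib algebra_simps)
  have "ev \<kappa> h (p * q) = ev \<kappa> h ((\<Sum>m\<in>Poly_Mapping.keys p. Poly_Mapping.single m (Poly_Mapping.lookup p m)) *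
      (\<Sum>m\<in>Poly_Mapping.keys q. Poly_Mapping.single m (Poly_Mapping.lookup q m)))"
    by (simp flip: poly_mapping_eq_sum_single)
  also have "\<dots> = ev \<kappa> h (\<Sum>m\<in>Poly_Mapping.keys p. Poly_Mapping.single m (Poly_Mapping.lookup p m)) *
      ev \<kappa> h (\<Sum>m\<in>Poly_Mapping.keys q. Poly_Mapping.single m (Poly_Mapping.lookup q m))"
    by (simp add: sum_product ev_sum single)
  finally show ?thesis
    by (simp flip: poly_mapping_eq_sum_single)
qed

lemma is_hom_ev: "is_hom (ev \<kappa> h)"
  using ev_mconst[of 1] by (intro is_homI) (simp_all add: ev_add ev_mult hom_1[OF k])

end

lemma hom_eqI:
  fixes f g :: "('v::finite, 'a::comm_ring_1) mpoly \<Rightarrow> 'b::comm_ring_1"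
  assumes "is_hom f" "is_hom g" "\<And>c. f (mconst c) = g (mconst c)" "\<And>v. f (mvar v) = g (mvar v)"
  shows "f p = g p"
  by (induction p rule: mpoly_induct)
     (simp_all add: assms hom_add[OF assms(1)] hom_add[OF assms(2)] hom_mult[OF assms(1)] hom_mult[OF assms(2)])

lemma ev_mvar_id: "ev mconst mvar p = p"
  by (rule hom_eqI[OF is_hom_ev]) (simp_all add: is_hom_mconst ev_mconst ev_mvar is_homI)

lemma is_hom_msubst: "is_hom (\<lambda>w. msubst w F)"
  using is_hom_ev[OF is_hom_mconst] by (simp add: msubst_eq_ev[abs_def])

lemmas msubst_hom = hom_0[OF is_hom_msubst] hom_1[OF is_hom_msubst] hom_add[OF is_hom_msubst]
  hom_mult[OF is_hom_msubst] hom_power[OF is_hom_msubst] hom_diff[OF is_hom_msubst]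
  hom_uminus[OF is_hom_msubst]

lemma msubst_mconst: "msubst (mconst c) F = mconst c"
  by (simp add: msubst_eq_ev ev_mconst[OF is_hom_mconst])

lemma msubst_mvar: "msubst (mvar v) F = F v"
  by (simp add: msubst_eq_ev ev_mvar[OF is_hom_mconst])

text \<open>The subring \<open>K[S]\<close>, kept as a subset of the full polynomial ring so that
  inductions on \<open>S\<close> stay within one type.\<close>

definition polys_in :: "'v set \<Rightarrow> ('v, 'a::zero) mpoly set" where
  "polys_in S = {p. \<forall>m\<in>Poly_Mapping.keys p. Poly_Mapping.keys m \<subseteq> S}"

lemma polys_in_UNIV [simp]: "polys_in UNIV = UNIV"
  by (simp add: polys_in_def)

lemma polys_in_mono: "S \<subseteq> T \<Longrightarrow> polys_in S \<subseteq> polys_in T"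
  by (auto simp: polys_in_def)

lemma polys_in_mconst [simp]: "mconst c \<in> polys_in S"
  by (simp add: polys_in_def mconst_def)

lemma polys_in_0 [simp]: "0 \<in> polys_in S" and polys_in_1 [simp]: "1 \<in> polys_in S"
  by (simp_all add: polys_in_def)

lemma polys_in_mvar [simp]: "v \<in> S \<Longrightarrow> mvar v \<in> polys_in S"
  by (simp add: polys_in_def mvar_def)

lemma polys_in_add: "p \<in> polys_in S \<Longrightarrow> q \<in> polys_in S \<Longrightarrow> p + q \<in> polys_in S"
  using Poly_Mapping.keys_add[of p q] unfolding polys_in_def by blast

lemma polys_in_uminus: "p \<in> polys_in S \<Longrightarrow> - p \<in> polys_in S"
  for p :: "('v, 'a::ab_group_add) mpoly"
  by (simp add: polys_in_def in_keys_iff)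

lemma polys_in_diff: "p \<in> polys_in S \<Longrightarrow> q \<in> polys_in S \<Longrightarrow> p - q \<in> polys_in S"
  for p :: "('v, 'a::ab_group_add) mpoly"
  using polys_in_add[of p S "- q"] by (simp add: polys_in_uminus)

lemma polys_in_mult: "p \<in> polys_in S \<Longrightarrow> q \<in> polys_in S \<Longrightarrow> p * q \<in> polys_in S"
  for p :: "('v, 'a::comm_ring_1) mpoly"
proof -
  assume pq: "p \<in> polys_in S" "q \<in> polys_in S"
  have "Poly_Mapping.keys m \<subseteq> S" if m: "m \<in> Poly_Mapping.keys (p * q)" for m
  proof -
    from m keys_mult[of p q] obtain a b where
      "m = a + b" "a \<in> Poly_Mapping.keys p" "b \<in> Poly_Mapping.keys q"
      by auto
    then show ?thesis
      using pq Poly_Mapping.keys_add[of a b] unfolding polys_in_def by blast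
  qed
  then show ?thesis
    by (simp add: polys_in_def)
qed

lemma polys_in_power: "p \<in> polys_in S \<Longrightarrow> p ^ k \<in> polys_in S"
  for p :: "('v, 'a::comm_ring_1) mpoly"
  by (induction k) (simp_all add: polys_in_mult)

lemma polys_in_sum: "(\<And>i. i \<in> A \<Longrightarrow> g i \<in> polys_in S) \<Longrightarrow> sum g A \<in> polys_in S"
  for g :: "'i \<Rightarrow> ('v, 'a::comm_ring_1) mpoly"
  by (induction A rule: infinite_finite_induct) (simp_all add: polys_in_add)

lemma ev_cong_polys_in:
  assumes "p \<in> polys_in S" "\<And>v. v \<in> S \<Longrightarrow> h v = h' v"
  shows "ev \<kappa> h p = ev \<kappa> h' p"
proof -
  have "h v ^ Poly_Mapping.lookup m v = h' v ^ Poly_Mapping.lookup m v" if "m \<in> Poly_Mapping.keys p" for m v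
  proof (cases "v \<in> S")
    case False
    then have "Poly_Mapping.lookup m v = 0"
      using that assms(1) unfolding polys_in_def by (auto simp flip: not_in_keys_iff_lookup_eq_zero)
    then show ?thesis
      by simp
  qed (simp add: assms)
  then show ?thesis
    unfolding ev_def by (auto intro!: sum.cong)
qed

lemma polys_in_induct [consumes 1, case_names const var add mult]:
  fixes p :: "('v::finite, 'a::comm_ring_1) mpoly"
  assumes "p \<in> polys_in S" "\<And>c. P (mconst c)" "\<And>v. v \<in> S \<Longrightarrow> P (mvar v)"
    "\<And>p q. P p \<Longrightarrow> P q \<Longrightarrow> P (p + q)" "\<And>p q. P p \<Longrightarrow> P q \<Longrightarrow> P (p * q)"
  shows "P p"
proof -
  \<comment> \<open>Sending the variables outside \<open>S\<close> to zero fixes \<open>p\<close>,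
    and every value of this map is built from constants and variables in \<open>S\<close>.\<close>
  let ?\<sigma> = "ev mconst (\<lambda>v. if v \<in> S then mvar v else 0)"
  have "P (?\<sigma> q)" for q
    using assms(2)[of 0]
    by (induction q rule: mpoly_induct)
       (auto simp: assms ev_mconst[OF is_hom_mconst] ev_mvar[OF is_hom_mconst]
         ev_add[OF is_hom_mconst] ev_mult[OF is_hom_mconst])
  moreover have "?\<sigma> p = ev mconst mvar p"
    by (rule ev_cong_polys_in[OF assms(1)]) simp
  then have "?\<sigma> p = p"
    by (simp only: ev_mvar_id)
  ultimately show ?thesis
    by metis
qed

section \<open>Weighted degrees and partial derivatives\<close>

definition wt :: "('v::finite \<Rightarrow> nat) \<Rightarrow> ('v \<Rightarrow>\<^sub>0 nat) \<Rightarrow> nat" where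
  "wt \<omega> m = (\<Sum>v\<in>UNIV. \<omega> v * Poly_Mapping.lookup m v)"

lemma wt_add: "wt \<omega> (m + m') = wt \<omega> m + wt \<omega> m'"
  by (simp add: wt_def lookup_add algebra_simps sum.distrib)

lemma wt_single: "wt \<omega> (Poly_Mapping.single v k) = \<omega> v * k"
proof -
  have "wt \<omega> (Poly_Mapping.single v k) = (\<Sum>u\<in>UNIV. if u = v then \<omega> v * k else 0)"
    unfolding wt_def by (intro sum.cong) (auto simp: lookup_single "when_def")
  then show ?thesis by simp
qed

lemma wt_ge: "\<omega> v * Poly_Mapping.lookup m v \<le> wt \<omega> m"
  unfolding wt_def by (rule member_le_sum) auto

text \<open>Each variable \<open>x v\<close> becomes \<open>x v * t ^ \<omega> v\<close>, where
  \<open>t\<close> is the univariate indeterminate; the coefficient of \<open>t ^ k\<close> is the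
  component of weight \<open>k\<close>. Degree laws are thus inherited from
  \<open>degree\<close>.\<close>

definition grade :: "('v::finite \<Rightarrow> nat) \<Rightarrow> ('v, 'a::comm_ring_1) mpoly \<Rightarrow> ('v, 'a) mpoly poly" where
  "grade \<omega> = ev (\<lambda>c. [:mconst c:]) (\<lambda>v. monom (mvar v) (\<omega> v))"

lemma is_hom_grade: "is_hom (grade \<omega>)"
  unfolding grade_def by (rule is_hom_ev[OF is_hom_const_poly])

lemma prod_monom: "finite A \<Longrightarrow> (\<Prod>i\<in>A. monom (c i) (k i)) = monom (\<Prod>i\<in>A. c i) (\<Sum>i\<in>A. k i)"
  for c :: "'i \<Rightarrow> 'b::comm_ring_1"
  by (induction A rule: finite_induct) (simp_all add: mult_monom)

lemma grade_eq:
  "grade \<omega> p = (\<Sum>m\<in>Poly_Mapping.keys p. monom (Poly_Mapping.single m (Poly_Mapping.lookup p m)) (wt \<omega> m))"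
  unfolding grade_def ev_def
  by (intro sum.cong)
     (simp_all add: monom_power prod_monom monomial_eq_prod wt_def smult_monom mult.commute)

lemma lookup_coeff_grade:
  "Poly_Mapping.lookup (coeff (grade \<omega> p) k) m = (if wt \<omega> m = k then Poly_Mapping.lookup p m else 0)"
proof -
  have "Poly_Mapping.lookup (coeff (grade \<omega> p) k) m =
      (\<Sum>m'\<in>Poly_Mapping.keys p. if m' = m then (if wt \<omega> m = k then Poly_Mapping.lookup p m else 0) else 0)"
    unfolding grade_eq coeff_sum lookup_sum
    by (intro sum.cong) (auto simp: lookup_single "when_def")
  then show ?thesis
    by (auto simp: sum.delta in_keys_iff)
qed

definition wdeg :: "('v::finite \<Rightarrow> nat) \<Rightarrow> ('v, 'a::comm_ring_1) mpoly \<Rightarrow> nat" where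
  "wdeg \<omega> p = degree (grade \<omega> p)"

lemma wt_le_wdeg:
  assumes "m \<in> Poly_Mapping.keys p"
  shows "wt \<omega> m \<le> wdeg \<omega> p"
proof -
  have "Poly_Mapping.lookup (coeff (grade \<omega> p) (wt \<omega> m)) m \<noteq> 0"
    using assms by (simp add: lookup_coeff_grade in_keys_iff)
  then show ?thesis
    unfolding wdeg_def by (intro le_degree) auto
qed

lemma grade_eq_0_iff: "grade \<omega> p = 0 \<longleftrightarrow> p = 0"
proof
  assume "grade \<omega> p = 0"
  then show "p = 0"
    using lookup_coeff_grade[of \<omega> p] by (intro poly_mapping_eqI) (metis coeff_0 lookup_zero)
qed (simp add: hom_0[OF is_hom_grade])

lemma wdeg_attained:
  assumes "p \<noteq> 0"
  obtains m where "m \<in> Poly_Mapping.keys p" "wt \<omega> m = wdeg \<omega> p"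
proof -
  have "coeff (grade \<omega> p) (wdeg \<omega> p) \<noteq> 0"
    using assms by (simp add: wdeg_def grade_eq_0_iff)
  then obtain m where "Poly_Mapping.lookup (coeff (grade \<omega> p) (wdeg \<omega> p)) m \<noteq> 0"
    by (metis poly_mapping_eqI lookup_zero)
  then show ?thesis
    using that by (auto simp: lookup_coeff_grade in_keys_iff split: if_splits)
qed

lemma wdeg_0 [simp]: "wdeg \<omega> 0 = 0"
  by (simp add: wdeg_def hom_0[OF is_hom_grade])

lemma wdeg_1 [simp]: "wdeg \<omega> 1 = 0"
  by (simp add: wdeg_def hom_1[OF is_hom_grade])

lemma wdeg_le:
  assumes "\<And>m. m \<in> Poly_Mapping.keys p \<Longrightarrow> wt \<omega> m \<le> k"
  shows "wdeg \<omega> p \<le> k"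
  using assms by (cases "p = 0") (simp, metis wdeg_attained)

lemma wdeg_add_le: "wdeg \<omega> (p + q) \<le> max (wdeg \<omega> p) (wdeg \<omega> q)"
  unfolding wdeg_def hom_add[OF is_hom_grade] by (rule degree_add_le_max)

lemma wdeg_add_eq_left: "wdeg \<omega> q < wdeg \<omega> p \<Longrightarrow> wdeg \<omega> (p + q) = wdeg \<omega> p"
  unfolding wdeg_def hom_add[OF is_hom_grade] by (rule degree_add_eq_left)

lemma wdeg_mvar_power: "wdeg \<omega> (mvar v ^ k :: ('v::finite, 'a::comm_ring_1) mpoly) = \<omega> v * k"
proof (rule antisym)
  have keys: "Poly_Mapping.keys (mvar v ^ k :: ('v, 'a) mpoly) = {Poly_Mapping.single v k}"
    by (simp add: mvar_power)
  show "wdeg \<omega> (mvar v ^ k :: ('v, 'a) mpoly) \<le> \<omega> v * k"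
    by (rule wdeg_le) (simp add: keys wt_single)
  show "\<omega> v * k \<le> wdeg \<omega> (mvar v ^ k :: ('v, 'a) mpoly)"
    using wt_le_wdeg[of "Poly_Mapping.single v k" "mvar v ^ k :: ('v, 'a) mpoly" \<omega>] by (simp add: keys wt_single)
qed

lemma mult_wdeg_indicator_le:
  assumes "\<omega> v = k"
  shows "k * wdeg (\<lambda>u. if u = v then 1 else 0) p \<le> wdeg \<omega> p"
proof (cases "p = 0")
  case False
  obtain m where m: "m \<in> Poly_Mapping.keys p" "wt (\<lambda>u. if u = v then 1 else 0) m = wdeg (\<lambda>u. if u = v then 1 else 0) p"
    using wdeg_attained[OF False] by blast
  have "wt (\<lambda>u. if u = v then 1 else 0) m = Poly_Mapping.lookup m v"
    unfolding wt_def by (subst sum.cong[OF refl, of _ _ "\<lambda>u. if u = v then Poly_Mapping.lookup m v else 0"]) auto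
  then have "k * wdeg (\<lambda>u. if u = v then 1 else 0) p \<le> wt \<omega> m"
    using wt_ge[of \<omega> v m] m assms by simp
  also have "\<dots> \<le> wdeg \<omega> p"
    by (rule wt_le_wdeg[OF m(1)])
  finally show ?thesis .
qed simp

text \<open>Once membership in \<open>K[S]\<close> is the vanishing of a degree, additivity of
  degrees shows that divisors stay in \<open>K[S]\<close>.\<close>

lemma polys_in_iff_wdeg: "p \<in> polys_in S \<longleftrightarrow> wdeg (\<lambda>v. if v \<in> S then 0 else 1) p = 0"
proof -
  let ?\<omega> = "\<lambda>v. if v \<in> S then 0 else 1 :: nat"
  have wt0: "wt ?\<omega> m = 0 \<longleftrightarrow> Poly_Mapping.keys m \<subseteq> S" for m
    by (auto simp: wt_def in_keys_iff split: if_splits)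
  show ?thesis
  proof
    assume "p \<in> polys_in S"
    then have "wdeg ?\<omega> p \<le> 0"
      by (intro wdeg_le) (auto simp: polys_in_def wt0)
    then show "wdeg ?\<omega> p = 0" by simp
  next
    assume *: "wdeg ?\<omega> p = 0"
    have "wt ?\<omega> m = 0" if "m \<in> Poly_Mapping.keys p" for m
      using wt_le_wdeg[OF that, of ?\<omega>] * by simp
    then show "p \<in> polys_in S"
      by (simp add: polys_in_def wt0)
  qed
qed

lemma polys_in_empty: "p \<in> polys_in {} \<Longrightarrow> p = mconst (Poly_Mapping.lookup p 0)"
  by (rule poly_mapping_eqI)
     (auto simp: polys_in_def mconst_def lookup_single "when_def" in_keys_iff)

lemma wdeg_one_eq_0: "wdeg (\<lambda>_. 1) p = 0 \<Longrightarrow> p = mconst (Poly_Mapping.lookup p 0)"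
  by (rule polys_in_empty) (simp add: polys_in_iff_wdeg)

lemma wdeg_one_pos:
  assumes "wdeg \<omega> p > 0"
  shows "wdeg (\<lambda>_. 1) p > 0"
proof (rule ccontr)
  assume "\<not> ?thesis"
  then have "p = mconst (Poly_Mapping.lookup p 0)"
    by (intro wdeg_one_eq_0) simp
  moreover have "wdeg \<omega> (mconst c) = 0" for c :: 'b
    by (simp add: wdeg_def grade_def ev_mconst[OF is_hom_const_poly])
  ultimately show False
    using assms by (metis less_irrefl)
qed

lemma wdeg_mult:
  fixes p q :: "('v::{finite,linorder}, 'a::idom) mpoly"
  assumes "p \<noteq> 0" "q \<noteq> 0"
  shows "wdeg \<omega> (p * q) = wdeg \<omega> p + wdeg \<omega> q"
  unfolding wdeg_def hom_mult[OF is_hom_grade]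
  using assms by (intro degree_mult_eq) (simp_all add: grade_eq_0_iff)

lemma wdeg_power:
  fixes p :: "('v::{finite,linorder}, 'a::idom) mpoly"
  assumes "p \<noteq> 0"
  shows "wdeg \<omega> (p ^ k) = k * wdeg \<omega> p"
  by (induction k) (simp_all add: wdeg_mult assms)

lemma wdeg_dvd_le:
  fixes p q :: "('v::{finite,linorder}, 'a::idom) mpoly"
  assumes "p dvd q" "q \<noteq> 0"
  shows "wdeg \<omega> p \<le> wdeg \<omega> q"
  using assms by (auto simp: wdeg_mult)

lemma polys_in_dvd:
  fixes p q :: "('v::{finite,linorder}, 'a::idom) mpoly"
  assumes "p dvd q" "q \<noteq> 0" "q \<in> polys_in S"
  shows "p \<in> polys_in S"
  using wdeg_dvd_le[OF assms(1,2), of "\<lambda>v. if v \<in> S then 0 else 1"] assms(3)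
  by (simp add: polys_in_iff_wdeg)

section \<open>Units and irreducible factors\<close>

lemma is_unit_mpoly_iff:
  fixes p :: "('v::{finite,linorder}, 'a::field) mpoly"
  shows "p dvd 1 \<longleftrightarrow> p \<noteq> 0 \<and> wdeg (\<lambda>_. 1) p = 0"
proof
  assume "p dvd 1"
  then show "p \<noteq> 0 \<and> wdeg (\<lambda>_. 1) p = 0"
    using wdeg_dvd_le[of p 1 "\<lambda>_. 1"] by auto
next
  assume "p \<noteq> 0 \<and> wdeg (\<lambda>_. 1) p = 0"
  then obtain c where c: "p = mconst c" "c \<noteq> 0"
    using wdeg_one_eq_0[of p] by (metis mconst_eq_0_iff)
  have "1 = mconst c * mconst (inverse c)"
    using c(2) by (simp flip: hom_mult[OF is_hom_mconst])
  then show "p dvd 1"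
    unfolding c(1) by (rule dvdI)
qed

lemma mpoly_nonunit_iff:
  fixes p :: "('v::{finite,linorder}, 'a::field) mpoly"
  assumes "p \<noteq> 0"
  shows "\<not> p dvd 1 \<longleftrightarrow> wdeg (\<lambda>_. 1) p > 0"
  using assms by (simp add: is_unit_mpoly_iff)

text \<open>In a splitting into nonunits the total degree drops, while additivity leaves one factor
  of positive weighted degree. The free choice of weight allows asking for a factor that involves a
  prescribed variable.\<close>

lemma ex_irreducible_factor:
  fixes p :: "('v::{finite,linorder}, 'a::field) mpoly"
  assumes "wdeg \<omega> p > 0"
  obtains f where "irreducible f" "f dvd p" "wdeg \<omega> f > 0"
proof -
  have "\<exists>f. irreducible f \<and> f dvd p \<and> wdeg \<omega> f > 0"
    using assms
  proof (induction "wdeg (\<lambda>_. 1) p" arbitrary: p rule: less_induct)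
    case less
    have p: "p \<noteq> 0"
      using less.prems by auto
    have nonunit: "\<not> p dvd 1"
      using wdeg_one_pos[OF less.prems] by (simp add: mpoly_nonunit_iff p)
    show ?case
    proof (cases "irreducible p")
      case True
      then show ?thesis using less.prems by auto
    next
      case False
      then obtain a b where ab: "p = a * b" "\<not> a dvd 1" "\<not> b dvd 1"
        using p nonunit by (auto simp: irreducible_def)
      have nz: "a \<noteq> 0" "b \<noteq> 0"
        using p ab(1) by auto
      have lt: "wdeg (\<lambda>_. 1) a < wdeg (\<lambda>_. 1) p" "wdeg (\<lambda>_. 1) b < wdeg (\<lambda>_. 1) p"
        using ab nz by (simp_all add: wdeg_mult mpoly_nonunit_iff)
      have "wdeg \<omega> a > 0 \<or> wdeg \<omega> b > 0"
        using less.prems by (auto simp: ab(1) wdeg_mult nz)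
      then show ?thesis
        using less.hyps[OF lt(1)] less.hyps[OF lt(2)] ab(1) by (metis dvd_mult dvd_mult2)
    qed
  qed
  then show ?thesis using that by blast
qed

lemma ex_irreducible_dvd:
  fixes p :: "('v::{finite,linorder}, 'a::field) mpoly"
  assumes "p \<noteq> 0" "\<not> p dvd 1"
  obtains f where "irreducible f" "f dvd p"
proof -
  have "wdeg (\<lambda>_. 1) p > 0"
    using assms by (simp add: mpoly_nonunit_iff)
  then show ?thesis
    using that by (rule ex_irreducible_factor)
qed

section \<open>Partial derivatives and the chain rule\<close>

lemma lookup_mpderiv:
  "Poly_Mapping.lookup (mpderiv v p) m =
    of_nat (Suc (Poly_Mapping.lookup m v)) * Poly_Mapping.lookup p (m + Poly_Mapping.single v 1)"
proof -
  let ?m = "m + Poly_Mapping.single v 1"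
  have "Poly_Mapping.lookup (mpderiv v p) m =
      (\<Sum>k\<in>Poly_Mapping.keys p. if k = ?m then of_nat (Suc (Poly_Mapping.lookup m v)) * Poly_Mapping.lookup p ?m else 0)"
    unfolding mpderiv_def lookup_sum
  proof (intro sum.cong refl)
    fix k
    \<comment> \<open>Subtraction of exponents is truncated, hence reversible only if
      \<open>v\<close> occurs in \<open>k\<close>; otherwise the coefficient is zero.\<close>
    have *: "k - Poly_Mapping.single v 1 = m \<longleftrightarrow> k = ?m" if "Poly_Mapping.lookup k v > 0"
    proof
      assume "k - Poly_Mapping.single v 1 = m"
      then have "Poly_Mapping.lookup k u - Poly_Mapping.lookup (Poly_Mapping.single v 1) u = Poly_Mapping.lookup m u" for u
        by (metis lookup_minus)
      then show "k = ?m"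
        using that by (intro poly_mapping_eqI)
          (metis (no_types, opaque_lifting) One_nat_def Suc_leI add.right_neutral diff_zero le_add_diff_inverse2
            lookup_add lookup_single_eq lookup_single_not_eq)
    qed simp
    show "Poly_Mapping.lookup (Poly_Mapping.single (k - Poly_Mapping.single v 1) (of_nat (Poly_Mapping.lookup k v) * Poly_Mapping.lookup p k)) m =
        (if k = ?m then of_nat (Suc (Poly_Mapping.lookup m v)) * Poly_Mapping.lookup p ?m else 0)"
    proof (cases "Poly_Mapping.lookup k v = 0")
      case True
      then have "k \<noteq> ?m"
        by (auto simp: lookup_add)
      then show ?thesis
        using True by simp
    next
      case False
      then show ?thesis
        using * by (auto simp: lookup_single "when_def" lookup_add)
    qed
  qed
  then show ?thesis
    by (auto simp: sum.delta in_keys_iff)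
qed

lemma mpderiv_add: "mpderiv v (p + q) = mpderiv v p + mpderiv v q"
  by (rule poly_mapping_eqI) (simp add: lookup_mpderiv lookup_add algebra_simps)

lemma mpderiv_0 [simp]: "mpderiv v 0 = 0"
  by (simp add: mpderiv_def)

lemma mpderiv_sum: "mpderiv v (sum g A) = (\<Sum>i\<in>A. mpderiv v (g i))"
  by (induction A rule: infinite_finite_induct) (simp_all add: mpderiv_add)

lemma mpderiv_single:
  "mpderiv v (Poly_Mapping.single m c) =
    Poly_Mapping.single (m - Poly_Mapping.single v 1) (of_nat (Poly_Mapping.lookup m v) * c)"
  by (cases "c = 0") (simp_all add: mpderiv_def)

lemma mpderiv_mconst [simp]: "mpderiv v (mconst c) = 0"
  by (simp add: mconst_def mpderiv_single)

lemma mpderiv_mvar: "mpderiv v (mvar u) = (if u = v then 1 else 0)"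
  by (simp add: mvar_def mpderiv_single lookup_single "when_def")

lemma mpderiv_mult: "mpderiv v (p * q) = mpderiv v p * q + p * mpderiv v q"
proof -
  let ?s = "Poly_Mapping.single :: ('a \<Rightarrow>\<^sub>0 nat) \<Rightarrow> 'b \<Rightarrow> _"
  let ?e = "Poly_Mapping.single v 1 :: 'a \<Rightarrow>\<^sub>0 nat"
  \<comment> \<open>If \<open>v\<close> does not occur in \<open>m\<close>, both coefficients
    vanish, so the truncated exponents do no harm.\<close>
  have left: "?s (m + m' - ?e) (of_nat (Poly_Mapping.lookup m v) * c * c') =
      ?s (m - ?e) (of_nat (Poly_Mapping.lookup m v) * c) * ?s m' c'" for m m' c c'
  proof (cases "Poly_Mapping.lookup m v = 0")
    case False
    have "m + m' - ?e = (m - ?e) + m'"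
      using False by (intro poly_mapping_eqI) (auto simp: lookup_add lookup_minus lookup_single "when_def")
    then show ?thesis by (simp add: mult_single)
  qed (simp add: mult_single)
  have single: "mpderiv v (?s m c * ?s m' c') = mpderiv v (?s m c) * ?s m' c' + ?s m c * mpderiv v (?s m' c')"
    for m c m' c'
  proof -
    have "mpderiv v (?s m c * ?s m' c') =
        ?s (m + m' - ?e) (of_nat (Poly_Mapping.lookup m v) * c * c') +
        ?s (m' + m - ?e) (of_nat (Poly_Mapping.lookup m' v) * c' * c)"
      unfolding add.commute[of m']
      by (simp add: mult_single mpderiv_single lookup_add distrib_right mult.assoc mult.commute[of c'] flip: single_add)
    then show ?thesis
      unfolding left by (simp add: mpderiv_single mult.commute)
  qed
  let ?P = "\<Sum>m\<in>Poly_Mapping.keys p. ?s m (Poly_Mapping.lookup p m)"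
  let ?Q = "\<Sum>m\<in>Poly_Mapping.keys q. ?s m (Poly_Mapping.lookup q m)"
  have "mpderiv v (?P * ?Q) = mpderiv v ?P * ?Q + ?P * mpderiv v ?Q"
    by (simp add: sum_product mpderiv_sum single sum.distrib)
  then show ?thesis
    by (simp flip: poly_mapping_eq_sum_single)
qed

text \<open>The chain rule: both sides obey the sum and product rules in \<open>w\<close>, so
  constants and variables decide.\<close>

lemma mpderiv_msubst:
  "mpderiv j (msubst w F) = (\<Sum>i\<in>UNIV. msubst (mpderiv i w) F * mpderiv j (F i))"
proof (induction w rule: mpoly_induct)
  case (var v)
  have "(\<Sum>i\<in>UNIV. msubst (mpderiv i (mvar v)) F * mpderiv j (F i)) = (\<Sum>i\<in>UNIV. if i = v then mpderiv j (F v) else 0)"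
    by (intro sum.cong) (auto simp: mpderiv_mvar msubst_hom)
  then show ?case
    by (simp add: msubst_mvar)
next
  case (mult p q)
  then show ?case
    by (simp add: msubst_hom mpderiv_mult sum.distrib sum_distrib_left sum_distrib_right algebra_simps)
qed (simp_all add: msubst_mconst msubst_hom mpderiv_add sum.distrib distrib_right)

lemma wdeg_mpderiv:
  assumes "mpderiv v p \<noteq> 0"
  shows "wdeg \<omega> (mpderiv v p) + \<omega> v \<le> wdeg \<omega> p"
proof -
  obtain m where m: "m \<in> Poly_Mapping.keys (mpderiv v p)" "wt \<omega> m = wdeg \<omega> (mpderiv v p)"
    using wdeg_attained[OF assms] by blast
  then have "m + Poly_Mapping.single v 1 \<in> Poly_Mapping.keys p"
    by (auto simp: in_keys_iff lookup_mpderiv)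
  from wt_le_wdeg[OF this, of \<omega>] m(2) show ?thesis
    by (simp add: wt_add wt_single)
qed

lemma polys_in_mpderiv:
  fixes p :: "('v::finite, 'a::comm_ring_1) mpoly"
  shows "p \<in> polys_in S \<Longrightarrow> mpderiv v p \<in> polys_in S"
  using wdeg_mpderiv[of v p "\<lambda>v. if v \<in> S then 0 else 1"]
  by (cases "mpderiv v p = 0") (auto simp: polys_in_iff_wdeg)

text \<open>Characteristic zero enters here: the exponents brought down by differentiation are
  nonzero factors.\<close>

lemma mpderiv_eq_0_iff:
  fixes p :: "('v::finite, 'a::{idom,ring_char_0}) mpoly"
  shows "mpderiv v p = 0 \<longleftrightarrow> p \<in> polys_in (- {v})"
proof
  assume "mpderiv v p = 0"
  then have *: "Poly_Mapping.lookup p (m + Poly_Mapping.single v 1) = 0" for m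
    using lookup_mpderiv[of v p m] by (metis lookup_zero mult_eq_0_iff of_nat_eq_0_iff nat.distinct(1))
  have "Poly_Mapping.lookup m v = 0" if "m \<in> Poly_Mapping.keys p" for m
  proof (rule ccontr)
    assume "Poly_Mapping.lookup m v \<noteq> 0"
    then have "m = (m - Poly_Mapping.single v 1) + Poly_Mapping.single v 1"
      by (intro poly_mapping_eqI) (auto simp: lookup_add lookup_minus lookup_single "when_def")
    then show False
      using *[of "m - Poly_Mapping.single v 1"] that by (simp add: in_keys_iff)
  qed
  then show "p \<in> polys_in (- {v})"
    by (auto simp: polys_in_def in_keys_iff)
next
  assume "p \<in> polys_in (- {v})"
  then have "Poly_Mapping.lookup m v = 0" if "Poly_Mapping.lookup p m \<noteq> 0" for m
    using that by (auto simp: polys_in_def in_keys_iff)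
  from this[of "_ + Poly_Mapping.single v 1"]
  have "Poly_Mapping.lookup p (m + Poly_Mapping.single v 1) = 0" for m
    by (auto simp: lookup_add)
  then show "mpderiv v p = 0"
    by (intro poly_mapping_eqI) (simp add: lookup_mpderiv)
qed

section \<open>Gauss's lemma: irreducible polynomials are prime\<close>

text \<open>The coefficients keep the type of polynomials in all variables but never involve
  \<open>v\<close>; evaluation at \<open>mvar v\<close> recovers the polynomial.\<close>

definition as_poly :: "'v \<Rightarrow> ('v::finite, 'a::comm_ring_1) mpoly \<Rightarrow> ('v, 'a) mpoly poly" where
  "as_poly v = ev (\<lambda>c. [:mconst c:]) (\<lambda>u. if u = v then [:0, 1:] else [:mvar u:])"

lemma is_hom_as_poly: "is_hom (as_poly v)"
  unfolding as_poly_def by (rule is_hom_ev[OF is_hom_const_poly])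

lemma as_poly_mconst: "as_poly v (mconst c) = [:mconst c:]"
  by (simp add: as_poly_def ev_mconst[OF is_hom_const_poly])

lemma as_poly_mvar: "as_poly v (mvar u) = (if u = v then [:0, 1:] else [:mvar u:])"
  by (simp add: as_poly_def ev_mvar[OF is_hom_const_poly])

lemmas as_poly_hom = hom_0[OF is_hom_as_poly] hom_1[OF is_hom_as_poly] hom_add[OF is_hom_as_poly]
  hom_mult[OF is_hom_as_poly] hom_diff[OF is_hom_as_poly] hom_sum[OF is_hom_as_poly]
  hom_power[OF is_hom_as_poly]

lemma poly_as_poly: "poly (as_poly v p) (mvar v) = p"
  by (rule hom_eqI[where f = "\<lambda>p. poly (as_poly v p) (mvar v)" and g = "\<lambda>p. p"])
     (auto intro!: is_homI simp: as_poly_hom as_poly_mconst as_poly_mvar)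

lemma as_poly_eq_0_iff: "as_poly v p = 0 \<longleftrightarrow> p = 0"
  by (metis as_poly_hom(1) poly_0 poly_as_poly)

lemma as_poly_free: "p \<in> polys_in (- {v}) \<Longrightarrow> as_poly v p = [:p:]"
  by (induction p rule: polys_in_induct)
     (auto simp: as_poly_mconst as_poly_mvar as_poly_hom)

lemma coeff_as_poly:
  assumes "p \<in> polys_in S"
  shows "coeff (as_poly v p) k \<in> polys_in (S - {v})"
proof -
  have "\<forall>k. coeff (as_poly v p) k \<in> polys_in (S - {v})"
    using assms
    by (induction p rule: polys_in_induct)
       (auto simp: as_poly_mconst as_poly_mvar as_poly_hom coeff_pCons coeff_mult
         intro!: polys_in_add polys_in_sum polys_in_mult split: nat.splits)
  then show ?thesis ..
qed

lemma as_poly_poly: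
  assumes "\<And>k. coeff f k \<in> polys_in (- {v})"
  shows "as_poly v (poly f (mvar v)) = f"
proof -
  have "as_poly v (poly f (mvar v)) = (\<Sum>k\<le>degree f. [:coeff f k:] * [:0, 1:] ^ k)"
    by (simp add: poly_altdef as_poly_hom as_poly_free[OF assms] as_poly_mvar)
  also have "\<dots> = f"
    by (subst (3) poly_as_sum_of_monoms[of f, symmetric]) (simp add: monom_altdef)
  finally show ?thesis .
qed

lemma polys_in_poly:
  fixes f :: "('v, 'a::comm_ring_1) mpoly poly"
  assumes "\<And>k. coeff f k \<in> polys_in S" "v \<in> S"
  shows "poly f (mvar v) \<in> polys_in S"
  unfolding poly_altdef using assms by (intro polys_in_sum polys_in_mult polys_in_power) simp_all

text \<open>Division without fractions: \<open>f\<close> is multiplied by the leading coefficient of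
  \<open>g\<close> before each cancellation of its leading term, and these multipliers accumulate in
  \<open>c\<close>.\<close>

lemma pseudo_division_in:
  fixes f g :: "('v::{finite,linorder}, 'a::idom) mpoly poly"
  assumes "g \<noteq> 0" "\<And>k. coeff f k \<in> polys_in S" "\<And>k. coeff g k \<in> polys_in S"
  obtains c q where "c \<noteq> 0" "c \<in> polys_in S" "\<And>k. coeff q k \<in> polys_in S"
    "smult c f - q * g = 0 \<or> degree (smult c f - q * g) < degree g"
proof -
  have "\<exists>c q. c \<noteq> 0 \<and> c \<in> polys_in S \<and> (\<forall>k. coeff q k \<in> polys_in S) \<and>
      (smult c f - q * g = 0 \<or> degree (smult c f - q * g) < degree g)"
    using assms(2)
  proof (induction "degree f" arbitrary: f rule: less_induct)
    case less
    show ?case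
    proof (cases "f = 0 \<or> degree f < degree g")
      case True
      then show ?thesis
        by (intro exI[of _ 1] exI[of _ 0]) auto
    next
      case False
      let ?t = "monom (lead_coeff f) (degree f - degree g)"
      let ?f = "smult (lead_coeff g) f - ?t * g"
      have le: "degree ?f \<le> degree f"
        using False assms(1)
        by (intro degree_diff_le) (auto simp: degree_mult_eq degree_monom_eq)
      have t: "coeff ?t k \<in> polys_in S" for k
        using less.prems by (simp add: coeff_monom)
      have coeff_f: "coeff ?f k \<in> polys_in S" for k
        unfolding coeff_diff coeff_smult coeff_mult
        by (intro polys_in_diff polys_in_mult polys_in_sum less.prems assms(3) t)
      have "coeff (?t * g) (degree f) = lead_coeff f * lead_coeff g"
        using False coeff_monom_mult[of "lead_coeff f" "degree f - degree g" g "degree f"] by simp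
      then have 0: "coeff ?f (degree f) = 0"
        by (simp add: mult.commute)
      show ?thesis
      proof (cases "degree ?f < degree f")
        case True
        obtain c q where cq: "c \<noteq> 0" "c \<in> polys_in S" "\<And>k. coeff q k \<in> polys_in S"
          "smult c ?f - q * g = 0 \<or> degree (smult c ?f - q * g) < degree g"
          using less.hyps[OF True coeff_f] by auto
        have "smult (c * lead_coeff g) f - (q + smult c ?t) * g = smult c ?f - q * g"
          by (simp add: algebra_simps smult_diff_right)
        moreover have "coeff (q + smult c ?t) k \<in> polys_in S" for k
          unfolding coeff_add coeff_smult by (intro polys_in_add polys_in_mult cq t)
        moreover have "c * lead_coeff g \<noteq> 0" "c * lead_coeff g \<in> polys_in S"
          using assms cq by (auto intro: polys_in_mult)
        ultimately show ?thesis
          using cq(4) by metis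
      next
        \<comment> \<open>The coefficient at \<open>degree f\<close> has cancelled, so only the zero
          polynomial can fail to drop in degree.\<close>
        case deg: False
        then have "?f = 0"
          using 0 le by (metis leading_coeff_0_iff nat_less_le)
        then show ?thesis
          using assms(1,3) t by (intro exI[of _ "lead_coeff g"] exI[of _ ?t]) auto
      qed
    qed
  qed
  then show ?thesis
    using that by blast
qed

text \<open>The greatest common divisor of \<open>a\<close> and \<open>b\<close> over the field of fractions of the
  polynomials that do not involve \<open>v\<close>, with all denominators cleared.\<close>

lemma pseudo_gcd:
  fixes a b :: "('v::{finite,linorder}, 'a::idom) mpoly"
  assumes "a \<in> polys_in S" "b \<in> polys_in S" "a \<noteq> 0" "v \<in> S"
  obtains d r s c1 c2 q1 q2 where "d \<noteq> 0" "d = r * a + s * b" "c1 * a = q1 * d" "c2 * b = q2 * d"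
    "c1 \<noteq> 0" "c2 \<noteq> 0" "c1 \<in> polys_in (S - {v})" "c2 \<in> polys_in (S - {v})"
    "d \<in> polys_in S" "r \<in> polys_in S" "s \<in> polys_in S" "q1 \<in> polys_in S" "q2 \<in> polys_in S"
proof -
  \<comment> \<open>The ideal generated by \<open>a\<close> and \<open>b\<close> in
    \<open>K[S]\<close>; a nonzero element of least degree in \<open>v\<close> serves as the
    gcd.\<close>
  define I where "I = {r * a + s * b | r s. r \<in> polys_in S \<and> s \<in> polys_in S}"
  have I_lin: "c * x - q * y \<in> I" if "x \<in> I" "y \<in> I" "c \<in> polys_in S" "q \<in> polys_in S" for c q x y
  proof -
    from that obtain r s r' s' where *: "x = r * a + s * b" "y = r' * a + s' * b"
      "r \<in> polys_in S" "s \<in> polys_in S" "r' \<in> polys_in S" "s' \<in> polys_in S"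
      by (auto simp: I_def)
    have "c * x - q * y = (c * r - q * r') * a + (c * s - q * s') * b"
      by (simp add: * algebra_simps)
    moreover have "c * r - q * r' \<in> polys_in S" "c * s - q * s' \<in> polys_in S"
      using * that by (auto intro!: polys_in_diff polys_in_mult)
    ultimately show ?thesis
      by (auto simp: I_def)
  qed
  have I_S: "x \<in> polys_in S" if "x \<in> I" for x
    using that assms by (auto simp: I_def intro!: polys_in_add polys_in_mult)
  have aI: "a \<in> I" and bI: "b \<in> I"
    unfolding I_def using polys_in_0[of S] polys_in_1[of S] by (force intro: exI[of _ 0] exI[of _ 1])+
  obtain d where d: "d \<in> I" "d \<noteq> 0"
    and min: "\<And>x. x \<in> I \<Longrightarrow> x \<noteq> 0 \<Longrightarrow> degree (as_poly v d) \<le> degree (as_poly v x)"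
    using ex_has_least_nat[of "\<lambda>x. x \<in> I \<and> x \<noteq> 0" a "\<lambda>x. degree (as_poly v x)"] aI assms(3) by auto
  \<comment> \<open>The pseudo-remainder of \<open>x\<close> by \<open>d\<close> lies in
    \<open>I\<close>, so minimality of the degree of \<open>d\<close> makes it zero.\<close>
  have div: "\<exists>c q. c * x = q * d \<and> c \<noteq> 0 \<and> c \<in> polys_in (S - {v}) \<and> q \<in> polys_in S"
    if x: "x \<in> I" for x
  proof -
    have nz: "as_poly v d \<noteq> 0"
      using d by (simp add: as_poly_eq_0_iff)
    obtain c q where cq: "c \<noteq> 0" "c \<in> polys_in (S - {v})" "\<And>k. coeff q k \<in> polys_in (S - {v})"
      "smult c (as_poly v x) - q * as_poly v d = 0 \<or>
       degree (smult c (as_poly v x) - q * as_poly v d) < degree (as_poly v d)" (is "?R = 0 \<or> _")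
      using pseudo_division_in[OF nz coeff_as_poly[OF I_S[OF x]] coeff_as_poly[OF I_S[OF d(1)]]]
      by blast
    let ?q = "poly q (mvar v)"
    have sub: "polys_in (S - {v}) \<subseteq> polys_in S" "polys_in (S - {v}) \<subseteq> polys_in (- {v})"
      by (auto intro!: polys_in_mono)
    have q: "?q \<in> polys_in S"
      using cq(3) sub assms(4) by (intro polys_in_poly) auto
    have "as_poly v (c * x - ?q * d) = ?R"
    proof -
      have "as_poly v c = [:c:]"
        using cq(2) sub by (intro as_poly_free) auto
      moreover have "as_poly v ?q = q"
        using cq(3) sub by (intro as_poly_poly) auto
      ultimately show ?thesis
        by (simp add: as_poly_hom)
    qed
    moreover have "c * x - ?q * d \<in> I"
      using cq(2) sub q x d by (intro I_lin) auto
    ultimately have "c * x - ?q * d = 0"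
      using cq(4) min[of "c * x - ?q * d"] by (metis as_poly_eq_0_iff not_less)
    then show ?thesis
      using cq q by auto
  qed
  from d(1) obtain r s where rs: "d = r * a + s * b" "r \<in> polys_in S" "s \<in> polys_in S"
    by (auto simp: I_def)
  from div[OF aI] div[OF bI] show ?thesis
    using that[OF d(2) rs(1) _ _ _ _ _ _ I_S[OF d(1)] rs(2,3)] by blast
qed

text \<open>Gauss's argument: if \<open>i\<close> and \<open>j\<close> are the first indices at
  which \<open>c\<close> fails to divide the coefficients of \<open>f\<close> and \<open>g\<close>,
  then the coefficient of \<open>f * g\<close> at \<open>i + j\<close> is the product of these two
  plus multiples of \<open>c\<close>.\<close>

lemma const_poly_dvd_mult_in:
  fixes f g :: "('v::{finite,linorder}, 'a::idom) mpoly poly"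
  assumes prime: "\<And>x y. x \<in> polys_in S \<Longrightarrow> y \<in> polys_in S \<Longrightarrow> c dvd x * y \<Longrightarrow> c dvd x \<or> c dvd y"
    and f: "\<And>k. coeff f k \<in> polys_in S" and g: "\<And>k. coeff g k \<in> polys_in S"
    and dvd: "[:c:] dvd f * g"
  shows "[:c:] dvd f \<or> [:c:] dvd g"
proof (rule ccontr)
  assume "\<not> ?thesis"
  then have "\<exists>i. \<not> c dvd coeff f i" "\<exists>j. \<not> c dvd coeff g j"
    by (auto simp: const_poly_dvd_iff)
  then obtain i j where i: "\<not> c dvd coeff f i" "\<And>k. k < i \<Longrightarrow> c dvd coeff f k"
    and j: "\<not> c dvd coeff g j" "\<And>k. k < j \<Longrightarrow> c dvd coeff g k"
    using exists_least_iff[of "\<lambda>i. \<not> c dvd coeff f i"] exists_least_iff[of "\<lambda>j. \<not> c dvd coeff g j"]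
    by blast
  have rest: "c dvd (\<Sum>k\<in>{..i + j} - {i}. coeff f k * coeff g (i + j - k))"
  proof (intro dvd_sum)
    fix k assume "k \<in> {..i + j} - {i}"
    then have "k < i \<or> i + j - k < j"
      by auto
    then show "c dvd coeff f k * coeff g (i + j - k)"
      by (elim disjE) (simp_all add: i(2) j(2))
  qed
  have "coeff (f * g) (i + j) = coeff f i * coeff g j + (\<Sum>k\<in>{..i + j} - {i}. coeff f k * coeff g (i + j - k))"
    unfolding coeff_mult by (subst sum.remove[of _ i]) auto
  moreover have "c dvd coeff (f * g) (i + j)"
    using dvd by (simp add: const_poly_dvd_iff)
  ultimately have "c dvd coeff f i * coeff g j"
    by (simp add: dvd_add_left_iff[OF rest])
  from prime[OF f g this] show False
    using i(1) j(1) by simp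
qed

section \<open>Induction step of primality: adjoining one variable\<close>

context
  fixes S :: "'v::{finite,linorder} set" and v :: 'v
  assumes v: "v \<notin> S"
    and prime_S: "\<And>p a b :: ('v, 'a::field) mpoly. irreducible p \<Longrightarrow> p \<in> polys_in S \<Longrightarrow>
      a \<in> polys_in S \<Longrightarrow> b \<in> polys_in S \<Longrightarrow> p dvd a * b \<Longrightarrow> p dvd a \<or> p dvd b"
begin

private lemma prime_const:
  fixes p a b :: "('v, 'a) mpoly"
  assumes p: "irreducible p" "p \<in> polys_in S"
    and ab: "a \<in> polys_in (insert v S)" "b \<in> polys_in (insert v S)" "p dvd a * b"
  shows "p dvd a \<or> p dvd b"
proof -
  have S: "insert v S - {v} = S"
    using v by auto
  have p': "as_poly v p = [:p:]"
    using p(2) v polys_in_mono[of S "- {v}"] by (intro as_poly_free) auto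
  have "as_poly v p dvd as_poly v a * as_poly v b"
    using hom_dvd[OF is_hom_as_poly ab(3)] by (simp add: as_poly_hom)
  then have "[:p:] dvd as_poly v a \<or> [:p:] dvd as_poly v b"
    using coeff_as_poly[OF ab(1), of v] coeff_as_poly[OF ab(2), of v] prime_S[OF p] S
    unfolding p' by (intro const_poly_dvd_mult_in[where S = S]) auto
  then have "poly [:p:] (mvar v) dvd poly (as_poly v a) (mvar v) \<or> poly [:p:] (mvar v) dvd poly (as_poly v b) (mvar v)"
    by (auto elim!: dvdE)
  then show ?thesis
    by (simp add: poly_as_poly)
qed

text \<open>The irreducible factors of \<open>c\<close> are prime, so they can be cancelled one by
  one against \<open>q\<close> or \<open>d\<close>; those taken from \<open>d\<close> make up
  \<open>c'\<close>.\<close>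

private lemma cancel_const:
  fixes c p q d :: "('v, 'a) mpoly"
  assumes "c \<noteq> 0" "c \<in> polys_in S" "p \<in> polys_in (insert v S)" "p \<noteq> 0" "c * p = q * d"
  shows "\<exists>c' d' q'. d = c' * d' \<and> c' \<in> polys_in S \<and> p = q' * d'"
  using assms
proof (induction "wdeg (\<lambda>_. 1) c" arbitrary: c q d rule: less_induct)
  case less
  have nz: "q \<noteq> 0" "d \<noteq> 0"
    using less.prems by auto
  have cp: "c * p \<in> polys_in (insert v S)" "c * p \<noteq> 0"
    using less.prems(1-4) subsetD[OF polys_in_mono, of S "insert v S" c] by (auto intro!: polys_in_mult)
  have qd: "q \<in> polys_in (insert v S)" "d \<in> polys_in (insert v S)"
    by (rule polys_in_dvd[OF _ cp(2,1)]; simp add: less.prems(5))+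
  show ?case
  proof (cases "c dvd 1")
    case True
    then obtain e where e: "1 = c * e" ..
    have "p = e * (c * p)"
      using e by (metis mult.assoc mult.commute mult_1)
    then have "d = 1 * d \<and> 1 \<in> polys_in S \<and> p = (e * q) * d"
      by (simp add: less.prems mult.assoc)
    then show ?thesis by blast
  next
    case False
    then obtain \<pi> where \<pi>: "irreducible \<pi>" "\<pi> dvd c"
      using ex_irreducible_dvd less.prems(1) by blast
    then obtain c1 where c1: "c = \<pi> * c1"
      by (auto elim: dvdE)
    have nz': "\<pi> \<noteq> 0" "c1 \<noteq> 0"
      using less.prems(1) c1 by auto
    have in_S: "\<pi> \<in> polys_in S" "c1 \<in> polys_in S"
      by (rule polys_in_dvd[OF _ less.prems(1,2)]; simp add: c1)+
    have lt: "wdeg (\<lambda>_. 1) c1 < wdeg (\<lambda>_. 1) c"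
      using \<pi>(1) nz' mpoly_nonunit_iff[of \<pi>] by (simp add: c1 wdeg_mult irreducible_def)
    have "\<pi> dvd q * d"
      using c1 less.prems(5) by (metis dvd_triv_left mult.assoc)
    then consider q1 where "q = \<pi> * q1" | d1 where "d = \<pi> * d1"
      using prime_const[OF \<pi>(1) in_S(1) qd] by (auto elim!: dvdE)
    then show ?thesis
    proof cases
      case 1
      then have "c1 * p = q1 * d"
        using less.prems(5) nz' by (simp add: c1 mult.assoc)
      then show ?thesis
        using less.hyps[OF lt nz'(2) in_S(2) less.prems(3,4)] by blast
    next
      case 2
      then have "\<pi> * (c1 * p) = \<pi> * (q * d1)"
        using less.prems(5) by (simp add: c1 ac_simps)
      then have "c1 * p = q * d1"
        using nz' by simp
      then obtain c' d' q' where "d1 = c' * d'" "c' \<in> polys_in S" "p = q' * d'"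
        using less.hyps[OF lt nz'(2) in_S(2) less.prems(3,4)] by blast
      then have "d = (\<pi> * c') * d' \<and> \<pi> * c' \<in> polys_in S \<and> p = q' * d'"
        using in_S(1) by (simp add: 2 mult.assoc polys_in_mult)
      then show ?thesis by blast
    qed
  qed
qed

text \<open>In the splitting \<open>p = c' * d'\<close> from \<open>cancel_const\<close> the factor
  \<open>d'\<close> lies outside \<open>K[S]\<close>, so \<open>c'\<close> is a unit and
  \<open>p\<close> divides \<open>a\<close> together with \<open>d'\<close>.\<close>

private lemma dvd_cancel_const:
  fixes c p a :: "('v, 'a) mpoly"
  assumes "c \<noteq> 0" "c \<in> polys_in S" "a \<in> polys_in (insert v S)" "p dvd c * a"
    "irreducible p" "p \<notin> polys_in S"
  shows "p dvd a"
proof (cases "a = 0")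
  case False
  obtain e where e: "c * a = e * p"
    using assms(4) by (metis dvdE mult.commute)
  obtain c' d' q' where *: "p = c' * d'" "c' \<in> polys_in S" "a = q' * d'"
    using cancel_const[OF assms(1,2,3) False e] by blast
  have "d' \<notin> polys_in S"
    using * assms(6) polys_in_mult by blast
  then have "\<not> d' dvd 1"
    using polys_in_dvd[of d' 1 S] by auto
  then have "c' dvd 1"
    using assms(5) *(1) by (auto simp: irreducible_def)
  then have "p dvd d'"
    using mult_dvd_mono[of c' 1 d' d'] by (simp add: *(1))
  then show ?thesis
    by (simp add: *(3))
qed simp

text \<open>If \<open>p\<close> involves \<open>v\<close>, take its gcd \<open>d\<close> with
  \<open>a\<close> over the fractions of \<open>K[S]\<close>. Irreducibility leaves two cases:
  \<open>p\<close> divides \<open>d\<close>, hence \<open>a\<close> up to a factor in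
  \<open>K[S]\<close>; or \<open>d\<close> lies in \<open>K[S]\<close>, and the Bezout identity
  times \<open>b\<close> shows that \<open>p\<close> divides \<open>d * b\<close>.\<close>

lemma irreducible_dvd_mult_insert:
  fixes p a b :: "('v, 'a) mpoly"
  assumes p: "irreducible p" "p \<in> polys_in (insert v S)"
    and ab: "a \<in> polys_in (insert v S)" "b \<in> polys_in (insert v S)" "p dvd a * b"
  shows "p dvd a \<or> p dvd b"
proof (cases "p \<in> polys_in S")
  case True
  then show ?thesis using prime_const p ab by blast
next
  case False
  have S: "insert v S - {v} = S"
    using v by auto
  have p0: "p \<noteq> 0"
    using p by auto
  obtain d r s c1 c2 q1 q2 where d: "d \<noteq> 0" "d = r * p + s * a" "c1 * p = q1 * d" "c2 * a = q2 * d"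
    "c1 \<noteq> 0" "c2 \<noteq> 0" "c1 \<in> polys_in S" "c2 \<in> polys_in S"
    by (rule pseudo_gcd[OF p(2) ab(1) p0, of v]) (auto simp: S)
  obtain c' d' q' where *: "d = c' * d'" "c' \<in> polys_in S" "p = q' * d'"
    using cancel_const[OF d(5,7) p(2) p0 d(3)] by blast
  consider "q' dvd 1" | "d' dvd 1"
    using irreducibleD[OF p(1) *(3)] by blast
  then show ?thesis
  proof cases
    case 1
    then have "p dvd d'"
      using mult_dvd_mono[of q' 1 d' d'] by (simp add: *(3))
    then have "p dvd c2 * a"
      unfolding d(4) *(1) by (simp add: dvd_mult)
    then have "p dvd a"
      using dvd_cancel_const[OF d(6,8) ab(1)] p False by blast
    then show ?thesis ..
  next
    case 2
    then have "d' \<in> polys_in S"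
      using polys_in_dvd[of d' 1 S] by simp
    then have "d \<in> polys_in S"
      by (simp add: *(1,2) polys_in_mult)
    moreover have "d * b = (r * b) * p + s * (a * b)"
      by (simp add: d(2) algebra_simps)
    then have "p dvd d * b"
      using ab(3) by simp
    ultimately have "p dvd b"
      using dvd_cancel_const[OF d(1) _ ab(2)] p False by blast
    then show ?thesis ..
  qed
qed

end

lemma irreducible_dvd_mult_in:
  fixes p a b :: "('v::{finite,linorder}, 'a::field) mpoly"
  assumes "finite S" "irreducible p" "p \<in> polys_in S" "a \<in> polys_in S" "b \<in> polys_in S" "p dvd a * b"
  shows "p dvd a \<or> p dvd b"
  using assms
proof (induction S arbitrary: p a b rule: finite_induct)
  case empty
  then have "p = mconst (Poly_Mapping.lookup p 0)"
    by (intro polys_in_empty)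
  then have "wdeg (\<lambda>_. 1) p = 0"
    using empty by (simp add: polys_in_iff_wdeg)
  then have "p dvd 1"
    using empty.prems(1) mpoly_nonunit_iff[of p] by (auto simp: irreducible_def)
  then show ?case
    using empty.prems(1) by (simp add: irreducible_def)
next
  case (insert v S)
  show ?case
    by (rule irreducible_dvd_mult_insert[OF insert.hyps(2) insert.IH insert.prems])
qed

lemma irreducible_dvd_mult_iff:
  fixes p a b :: "('v::{finite,linorder}, 'a::field) mpoly"
  assumes "irreducible p"
  shows "p dvd a * b \<longleftrightarrow> p dvd a \<or> p dvd b"
  using irreducible_dvd_mult_in[of UNIV p a b] assms by auto

section \<open>Square-free polynomials\<close>

lemma squarefree_mult_irreducible:
  fixes f g :: "'a::comm_semiring_1"
  assumes "squarefree (f * g)" "irreducible f"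
  shows "\<not> f dvd g"
proof
  assume "f dvd g"
  then have "f ^ 2 dvd f * g"
    by (simp add: power2_eq_square mult_dvd_mono)
  then have "f dvd 1"
    by (rule squarefreeD[OF assms(1)])
  then show False
    using assms(2) by (simp add: irreducible_def)
qed

lemma squarefree_multD:
  fixes f g :: "'a::comm_semiring_1"
  assumes "squarefree (f * g)"
  shows "squarefree g"
  using assms unfolding squarefree_def by (metis dvd_mult)

text \<open>Splitting off an irreducible factor lowers the total degree, and square-freeness keeps
  that factor from dividing the rest.\<close>

lemma squarefree_mpoly_induct [consumes 1, case_names unit mult]:
  fixes g :: "('v::{finite,linorder}, 'a::field) mpoly"
  assumes "squarefree g" "\<And>u. u dvd 1 \<Longrightarrow> P u"
    "\<And>f g. irreducible f \<Longrightarrow> squarefree (f * g) \<Longrightarrow> \<not> f dvd g \<Longrightarrow> P g \<Longrightarrow> P (f * g)"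
  shows "P g"
  using assms(1)
proof (induction "wdeg (\<lambda>_. 1) g" arbitrary: g rule: less_induct)
  case less
  have g0: "g \<noteq> 0"
    using less.prems not_squarefree_0 by blast
  show ?case
  proof (cases "g dvd 1")
    case False
    then obtain f h where f: "irreducible f" "g = f * h"
      using ex_irreducible_dvd[OF g0] by (metis dvdE)
    have "f \<noteq> 0" "h \<noteq> 0"
      using g0 f by auto
    moreover have "wdeg (\<lambda>_. 1) f > 0"
      using f(1) \<open>f \<noteq> 0\<close> mpoly_nonunit_iff[of f] by (simp add: irreducible_def)
    ultimately have "P h"
      using less.prems by (intro less.hyps) (auto simp: f(2) wdeg_mult intro: squarefree_multD)
    then show ?thesis
      using f less.prems squarefree_mult_irreducible[of f h] assms(3) by metis
  qed (rule assms(2))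
qed

lemma squarefree_dvd_iff:
  fixes g q :: "('v::{finite,linorder}, 'a::field) mpoly"
  assumes "squarefree g"
  shows "g dvd q \<longleftrightarrow> (\<forall>f. irreducible f \<and> f dvd g \<longrightarrow> f dvd q)"
proof
  assume "\<forall>f. irreducible f \<and> f dvd g \<longrightarrow> f dvd q"
  with assms show "g dvd q"
  proof (induction g rule: squarefree_mpoly_induct)
    case (unit u)
    then show ?case by (meson dvd_trans one_dvd)
  next
    case (mult f g)
    from mult.prems have "g dvd q"
      by (intro mult.IH) auto
    then obtain q' where q': "q = g * q'" ..
    have "f dvd g * q'"
      using mult.prems mult.hyps(1) by (simp flip: q')
    then have "f dvd q'"
      using mult.hyps by (simp add: irreducible_dvd_mult_iff)
    then have "f * g dvd q' * g"
      by (rule mult_dvd_mono) simp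
    then show ?case
      by (simp add: q' mult.commute)
  qed
qed (blast intro: dvd_trans)

lemma irreducible_power2_dvd_mult:
  fixes f a b :: "('v::{finite,linorder}, 'a::field) mpoly"
  assumes "irreducible f" "\<not> f dvd a" "f ^ 2 dvd a * b"
  shows "f ^ 2 dvd b"
proof -
  have f0: "f \<noteq> 0"
    using assms(1) by auto
  have "f dvd a * b"
    using assms(3) by (auto simp: power2_eq_square elim: dvd_mult_left)
  then have "f dvd b"
    using assms by (simp add: irreducible_dvd_mult_iff)
  then obtain c where c: "b = f * c" ..
  have "f * f dvd f * (a * c)"
    using assms(3) by (simp add: c power2_eq_square ac_simps)
  then have "f dvd a * c"
    using f0 by simp
  then have "f dvd c"
    using assms by (simp add: irreducible_dvd_mult_iff)
  then show ?thesis
    by (simp add: c power2_eq_square)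
qed

lemma squarefree_mult_irreducible_iff:
  fixes f g :: "('v::{finite,linorder}, 'a::field) mpoly"
  assumes "irreducible f" "squarefree g" "\<not> f dvd g"
  shows "squarefree (f * g)"
proof (rule squarefreeI, rule ccontr)
  fix x assume x: "x ^ 2 dvd f * g" "\<not> x dvd 1"
  have "f \<noteq> 0" "g \<noteq> 0"
    using assms not_squarefree_0 by auto
  then have "x \<noteq> 0"
    using x(1) by auto
  then obtain p where p: "irreducible p" "p dvd x"
    using ex_irreducible_dvd x(2) by blast
  have p2: "p ^ 2 dvd f * g"
    using p(2) x(1) by (meson dvd_power_same dvd_trans)
  show False
  \<comment> \<open>Either \<open>p\<close> is an associate of \<open>f\<close>, and then
    \<open>f\<close> divides \<open>g\<close>, or the square of \<open>p\<close> divides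
    \<open>g\<close>; both are excluded.\<close>
  proof (cases "p dvd f")
    case True
    then obtain u where u: "f = p * u" ..
    then have "u dvd 1"
      using irreducibleD[OF assms(1) u] p(1) by (simp add: irreducible_def)
    then have "f dvd p"
      using mult_dvd_mono[of u 1 p p] by (simp add: u mult.commute)
    then have "f ^ 2 dvd f * g"
      using p2 by (meson dvd_power_same dvd_trans)
    then have "f dvd g"
      using \<open>f \<noteq> 0\<close> by (simp add: power2_eq_square)
    then show False
      using assms(3) by simp
  next
    case False
    then have "p ^ 2 dvd g"
      using irreducible_power2_dvd_mult[OF p(1) _ p2] by simp
    then have "p dvd 1"
      by (rule squarefreeD[OF assms(2)])
    then show False
      using p(1) by (simp add: irreducible_def)
  qed
qed

text \<open>Separability in characteristic zero: if the gcd of \<open>w\<close> and its derivative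
  involved \<open>v\<close>, an irreducible factor involving \<open>v\<close> would divide
  \<open>w\<close> twice. So the gcd itself is free of \<open>v\<close>.\<close>

lemma squarefree_bezout_mpderiv:
  fixes w :: "('v::{finite,linorder}, 'a::field_char_0) mpoly"
  assumes "squarefree w"
  obtains c r s where "c \<noteq> 0" "c \<in> polys_in (- {v})" "c = r * w + s * mpderiv v w"
proof -
  have w0: "w \<noteq> 0"
    using assms not_squarefree_0 by blast
  obtain d r s c1 c2 q1 q2 where d: "d \<noteq> 0" "d = r * w + s * mpderiv v w" "c1 * w = q1 * d"
    "c2 * mpderiv v w = q2 * d" "c1 \<noteq> 0" "c2 \<noteq> 0" "c1 \<in> polys_in (- {v})" "c2 \<in> polys_in (- {v})"
    by (rule pseudo_gcd[of w UNIV "mpderiv v w" v]) (auto simp: w0 Compl_eq_Diff_UNIV)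
  let ?\<omega> = "\<lambda>u. if u \<in> - {v} then 0 else 1 :: nat"
  have "d \<in> polys_in (- {v})"
  proof (rule ccontr)
    assume "d \<notin> polys_in (- {v})"
    then have "wdeg ?\<omega> d > 0"
      by (simp add: polys_in_iff_wdeg)
    then obtain f where f: "irreducible f" "f dvd d" "wdeg ?\<omega> f > 0"
      by (rule ex_irreducible_factor)
    then have f_v: "f \<notin> polys_in (- {v})"
      by (simp add: polys_in_iff_wdeg)
    have "f dvd c1 * w" "f dvd c2 * mpderiv v w"
      using f(2) by (simp_all add: d(3,4))
    then have fw: "f dvd w" "f dvd mpderiv v w"
      using d(5-8) f(1) f_v polys_in_dvd by (blast dest: irreducible_dvd_mult_iff[THEN iffD1])+
    obtain u where u: "w = f * u"
      using fw(1) ..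
    have nz: "mpderiv v f \<noteq> 0"
      using f_v by (simp add: mpderiv_eq_0_iff)
    \<comment> \<open>The derivative is nonzero and of smaller total degree than
      \<open>f\<close>.\<close>
    have "\<not> f dvd mpderiv v f"
      using wdeg_dvd_le[OF _ nz, of f "\<lambda>_. 1"] wdeg_mpderiv[OF nz, of "\<lambda>_. 1"] by auto
    moreover have "f dvd mpderiv v f * u"
      using fw(2) dvd_add_left_iff[of f "f * mpderiv v u"] by (simp add: u mpderiv_mult)
    ultimately have "f dvd u"
      using f(1) by (simp add: irreducible_dvd_mult_iff)
    then show False
      using squarefree_mult_irreducible[of f u] assms f(1) by (simp add: u)
  qed
  from that[OF d(1) this d(2)] show ?thesis .
qed

section \<open>Determinants modulo an element\<close>

text \<open>When row \<open>k\<close> is expanded linearly, each term with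
  \<open>l \<noteq> k\<close> has two equal rows.\<close>

lemma det_replace_row:
  fixes A :: "'a::comm_ring_1 ^ 'n::finite ^ 'n"
  shows "det (\<chi> i. if i = k then (\<Sum>l\<in>UNIV. c l *s A $ l) else A $ i) = c k * det A"
proof -
  have "det (\<chi> i. if i = k then A $ l else A $ i) = (if l = k then det A else 0)" for l
  proof (cases "l = k")
    case True
    have "(\<chi> i. if i = k then A $ l else A $ i) = A"
      using True by (simp add: vec_eq_iff)
    then show ?thesis using True by simp
  next
    case False
    show ?thesis
      using False det_identical_rows[of k l "\<chi> i. if i = k then A $ l else A $ i"]
      by (simp add: row_def)
  qed
  then have "det (\<chi> i. if i = k then (\<Sum>l\<in>UNIV. c l *s A $ l) else A $ i) =
      (\<Sum>l\<in>UNIV. c l * (if l = k then det A else 0))"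
    by (simp add: det_linear_row_sum det_row_mul)
  also have "\<dots> = (\<Sum>l\<in>UNIV. if l = k then c k * det A else 0)"
    by (intro sum.cong) auto
  finally show ?thesis by simp
qed

lemma prod_cong_dvd:
  fixes f g :: "'i \<Rightarrow> 'a::comm_ring_1"
  assumes "\<And>i. i \<in> A \<Longrightarrow> p dvd f i - g i"
  shows "p dvd prod f A - prod g A"
  using assms
proof (induction A rule: infinite_finite_induct)
  case (insert x A)
  have "prod f (insert x A) - prod g (insert x A) =
      (f x - g x) * prod f A + g x * (prod f A - prod g A)"
    using insert.hyps by (simp add: algebra_simps)
  then show ?case
    using insert.prems insert.IH by simp
qed auto

lemma det_cong_dvd:
  fixes A B :: "'a::comm_ring_1 ^ 'n::finite ^ 'n"
  assumes "\<And>i j. p dvd A $ i $ j - B $ i $ j"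
  shows "p dvd det A - det B"
proof -
  have "p dvd (\<Sum>\<pi>\<in>{\<pi>. \<pi> permutes (UNIV :: 'n set)}. of_int (sign \<pi>) *
      ((\<Prod>i\<in>UNIV. A $ i $ \<pi> i) - (\<Prod>i\<in>UNIV. B $ i $ \<pi> i)))"
    using assms by (intro dvd_sum dvd_mult prod_cong_dvd) auto
  then show ?thesis
    by (simp add: det_def sum_subtractf right_diff_distrib)
qed

text \<open>Linear algebra modulo \<open>p\<close> without a quotient ring: putting the combination
  into row \<open>k\<close> multiplies the determinant by \<open>c k\<close> and makes that row zero
  modulo \<open>p\<close>.\<close>

lemma dvd_det_dependent_rows:
  fixes A :: "'a::comm_ring_1 ^ 'n::finite ^ 'n"
  assumes "\<And>j. p dvd (\<Sum>i\<in>UNIV. c i * A $ i $ j)"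
  shows "p dvd c k * det A"
proof -
  have "p dvd det (\<chi> i. if i = k then (\<Sum>l\<in>UNIV. c l *s A $ l) else A $ i) -
      det (\<chi> i. if i = k then 0 else A $ i)"
    using assms by (intro det_cong_dvd) simp
  then show ?thesis
    by (simp add: det_replace_row det_row_0)
qed

section \<open>Existence of relations by counting dimensions\<close>

text \<open>Stated for a family because values may repeat; a repetition \<open>f i = f j\<close> is
  itself a dependence.\<close>

lemma (in vector_space) dependent_family:
  assumes "finite I" "finite B" "f ` I \<subseteq> span B" "card B < card I"
  obtains c i where "i \<in> I" "c i \<noteq> 0" "(\<Sum>i\<in>I. scale (c i) (f i)) = 0"
proof (cases "inj_on f I")
  case True
  have "dependent (f ` I)"
    using independent_span_bound[OF assms(2) _ assms(3)] assms(4) card_image[OF True] by fastforce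
  then obtain u x where u: "x \<in> f ` I" "u x \<noteq> 0" "(\<Sum>x\<in>f ` I. scale (u x) x) = 0"
    using assms(1) by (auto simp: dependent_finite)
  then show ?thesis
    using that[of _ "\<lambda>i. u (f i)"] by (auto simp: sum.reindex[OF True])
next
  case False
  then obtain i j where ij: "i \<in> I" "j \<in> I" "i \<noteq> j" "f i = f j"
    by (auto simp: inj_on_def)
  let ?c = "\<lambda>k. if k = i then 1 else if k = j then - 1 else 0 :: 'a"
  have "(\<Sum>k\<in>I. scale (?c k) (f k)) = (\<Sum>k\<in>{i, j}. scale (?c k) (f k))"
    using ij assms(1) by (intro sum.mono_neutral_right) auto
  also have "\<dots> = 0"
    using ij by simp
  finally show ?thesis
    using that[of i ?c] ij(1) by auto
qed

text \<open>Bounding each exponent separately, not the total degree, makes the number of monomials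
  an exact power.\<close>

definition box :: "nat \<Rightarrow> ('v::finite \<Rightarrow>\<^sub>0 nat) set" where
  "box N = {m. \<forall>v. Poly_Mapping.lookup m v \<le> N}"

lemma bij_betw_box: "bij_betw Poly_Mapping.lookup (box N :: ('v::finite \<Rightarrow>\<^sub>0 nat) set) (PiE UNIV (\<lambda>_. {..N}))"
proof (rule bij_betwI')
  fix f :: "'v \<Rightarrow> nat" assume "f \<in> PiE UNIV (\<lambda>_. {..N})"
  then show "\<exists>m\<in>box N. f = Poly_Mapping.lookup m"
    by (intro bexI[of _ "Abs_poly_mapping f"]) (auto simp: box_def)
next
  fix m :: "'v \<Rightarrow>\<^sub>0 nat" assume "m \<in> box N"
  then show "Poly_Mapping.lookup m \<in> PiE UNIV (\<lambda>_. {..N})"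
    by (auto simp: box_def)
qed (simp flip: poly_mapping_eq_iff)

lemma finite_box: "finite (box N)"
  using bij_betw_finite[OF bij_betw_box[of N]] by (simp add: finite_PiE)

lemma card_box: "card (box N :: ('v::finite \<Rightarrow>\<^sub>0 nat) set) = Suc N ^ CARD('v)"
  using bij_betw_same_card[OF bij_betw_box[of N]] by (simp add: card_PiE)

definition boxed :: "nat \<Rightarrow> ('v::finite, 'a::zero) mpoly set" where
  "boxed N = {p. Poly_Mapping.keys p \<subseteq> box N}"

lemma box_mono: "N \<le> M \<Longrightarrow> box N \<subseteq> box M"
  by (auto simp: box_def intro: le_trans)

lemma boxed_mono: "N \<le> M \<Longrightarrow> p \<in> boxed N \<Longrightarrow> p \<in> boxed M"
  using box_mono by (auto simp: boxed_def)

lemma boxed_1: "(1 :: ('v::finite, 'a::zero_neq_one) mpoly) \<in> boxed N"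
  by (simp add: boxed_def box_def)

lemma boxed_mult:
  fixes p q :: "('v::finite, 'a::comm_ring_1) mpoly"
  assumes "p \<in> boxed N" "q \<in> boxed M"
  shows "p * q \<in> boxed (N + M)"
proof -
  have "m \<in> box (N + M)" if "m \<in> Poly_Mapping.keys (p * q)" for m
  proof -
    from that keys_mult[of p q] obtain a b where
      "m = a + b" "a \<in> Poly_Mapping.keys p" "b \<in> Poly_Mapping.keys q"
      by auto
    then show ?thesis
      using assms by (auto simp: boxed_def box_def lookup_add intro!: add_mono)
  qed
  then show ?thesis
    by (auto simp: boxed_def)
qed

lemma boxed_power:
  fixes p :: "('v::finite, 'a::comm_ring_1) mpoly"
  assumes "p \<in> boxed N"
  shows "p ^ k \<in> boxed (k * N)"
  using assms by (induction k) (simp_all add: boxed_1 boxed_mult)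

lemma boxed_prod:
  fixes p :: "'i \<Rightarrow> ('v::finite, 'a::comm_ring_1) mpoly"
  assumes "\<And>i. i \<in> A \<Longrightarrow> p i \<in> boxed N"
  shows "prod p A \<in> boxed (card A * N)"
  using assms by (induction A rule: infinite_finite_induct) (simp_all add: boxed_1 boxed_mult)

lemma ex_boxed:
  fixes p :: "('v::finite, 'a::zero) mpoly"
  obtains N where "p \<in> boxed N"
proof
  let ?N = "Max (insert 0 ((\<lambda>(m, v). Poly_Mapping.lookup m v) ` (Poly_Mapping.keys p \<times> UNIV)))"
  show "p \<in> boxed ?N"
    by (auto simp: boxed_def box_def intro!: Max_ge)
qed

text \<open>Widening a cube from side \<open>a\<close> to \<open>a + e\<close> adds only a
  lower-order volume; this bounds the codimension of the multiples of \<open>g\<close>.\<close>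

lemma power_add_le: "(a + e) ^ Suc k \<le> a ^ Suc k + Suc k * e * (a + e) ^ k" for a e :: nat
proof (induction k)
  case (Suc k)
  have "(a + e) ^ Suc (Suc k) = a * (a + e) ^ Suc k + e * (a + e) ^ Suc k"
    by (simp add: algebra_simps)
  also have "\<dots> \<le> a * (a ^ Suc k + Suc k * e * (a + e) ^ k) + e * (a + e) ^ Suc k"
    using Suc.IH by (intro add_mono mult_le_mono) simp_all
  also have "\<dots> = a ^ Suc (Suc k) + Suc k * e * (a * (a + e) ^ k) + e * (a + e) ^ Suc k"
    by (simp add: algebra_simps)
  also have "\<dots> \<le> a ^ Suc (Suc k) + Suc k * e * (a + e) ^ Suc k + e * (a + e) ^ Suc k"
    by (intro add_mono mult_le_mono) simp_all
  also have "\<dots> = a ^ Suc (Suc k) + Suc (Suc k) * e * (a + e) ^ Suc k"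
    by (simp add: algebra_simps)
  finally show ?case .
qed simp

text \<open>The polynomials \<open>w(F)\<close> with exponents of \<open>w\<close> bounded by \<open>d\<close> and the multiples of \<open>g\<close> live in
  the space of polynomials with exponents bounded by \<open>n D d\<close>; for large \<open>d\<close> the number of
  parameters exceeds its dimension, so some \<open>w(F)\<close> is a multiple of \<open>g\<close>.\<close>

lemma ex_msubst_dvd:
  fixes F :: "'v::{finite,linorder} \<Rightarrow> ('v, 'a::field) mpoly"
  assumes "g \<noteq> 0"
  obtains w :: "('v, 'a) mpoly" where "w \<noteq> 0" "g dvd msubst w F"
proof -
  define n where "n = CARD('v)"
  obtain k where n: "n = Suc k"
    unfolding n_def using zero_less_card_finite[where 'a = 'v] gr0_implies_Suc by blast
  obtain e where e: "g \<in> boxed e"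
    by (rule ex_boxed)
  have "\<exists>D. \<forall>v. F v \<in> boxed D"
  proof -
    have "\<forall>v. \<exists>N. F v \<in> boxed N"
      using ex_boxed by metis
    then obtain N where N: "F v \<in> boxed (N v)" for v
      by metis
    have "F v \<in> boxed (Max (range N))" for v
      by (rule boxed_mono[OF _ N]) simp
    then show ?thesis by blast
  qed
  then obtain D' where D': "F v \<in> boxed D'" for v
    by blast
  \<comment> \<open>The successor makes \<open>D\<close> positive, which yields
    \<open>d \<le> N\<close> below.\<close>
  define D where "D = Suc D'"
  have D: "F v \<in> boxed D" for v
    by (rule boxed_mono[OF _ D']) (simp add: D_def)
  \<comment> \<open>Since \<open>N + 1 \<le> n * D * (d + 1)\<close>, the first summand makes
    \<open>(d + 1) ^ n\<close> exceed \<open>n * e * (N + 1) ^ k\<close>; the summand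
    \<open>e\<close> ensures \<open>e \<le> N\<close>.\<close>
  define d where "d = n * e * (n * D) ^ k + e"
  define N where "N = n * (d * D)"
  have "e \<le> d"
    by (simp add: d_def)
  also have "d = 1 * (d * 1)"
    by simp
  also have "\<dots> \<le> N"
    unfolding N_def by (intro mult_le_mono) (simp_all add: n D_def)
  finally have "e \<le> N" .
  then obtain a where a: "N = a + e"
    by (metis le_add_diff_inverse2)
  have "N + 1 \<le> n * D * (d + 1)"
    by (simp add: N_def n D_def algebra_simps)
  then have "n * e * (N + 1) ^ k \<le> n * e * (n * D * (d + 1)) ^ k"
    by (intro mult_le_mono power_mono) simp_all
  also have "\<dots> = (n * e * (n * D) ^ k) * (d + 1) ^ k"
    by (simp only: power_mult_distrib mult.assoc)
  also have "\<dots> < (d + 1) * (d + 1) ^ k"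
    by (intro mult_strict_right_mono) (simp_all add: d_def)
  finally have "n * e * (N + 1) ^ k < (d + 1) ^ n"
    by (simp add: n)
  with power_add_le[of "a + 1" e k] have card: "(N + 1) ^ n < (d + 1) ^ n + (a + 1) ^ n"
    by (simp add: n a ac_simps)
  interpret vs: vector_space "\<lambda>c (p :: ('v, 'a) mpoly). mconst c * p"
    by unfold_locales (simp_all add: algebra_simps hom_add[OF is_hom_mconst] hom_mult[OF is_hom_mconst])
  let ?B = "(\<lambda>m. Poly_Mapping.single m (1 :: 'a)) ` (box N :: ('v \<Rightarrow>\<^sub>0 nat) set)"
  have span: "p \<in> vs.span ?B" if "p \<in> boxed N" for p
  proof -
    have "p = (\<Sum>m\<in>Poly_Mapping.keys p. mconst (Poly_Mapping.lookup p m) * Poly_Mapping.single m 1)"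
      by (simp add: mconst_def mult_single flip: poly_mapping_eq_sum_single)
    also have "\<dots> \<in> vs.span ?B"
      using that by (intro vs.span_sum vs.span_scale vs.span_base) (auto simp: boxed_def)
    finally show ?thesis .
  qed
  \<comment> \<open>The left part lists the monomials evaluated at \<open>F\<close>, the right part
    the monomial multiples of \<open>g\<close>; a linear dependence reads
    \<open>w(F) + h * g = 0\<close>.\<close>
  let ?f = "case_sum (\<lambda>m. \<Prod>v\<in>UNIV. F v ^ Poly_Mapping.lookup m v) (\<lambda>m. Poly_Mapping.single m 1 * g)"
  let ?I = "(box d :: ('v \<Rightarrow>\<^sub>0 nat) set) <+> (box a :: ('v \<Rightarrow>\<^sub>0 nat) set)"
  have "?f i \<in> boxed N" if "i \<in> ?I" for i
  proof (cases i)
    case (Inl m)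
    then have m: "m \<in> box d"
      using that by auto
    have "F v ^ Poly_Mapping.lookup m v \<in> boxed (d * D)" for v
      using m by (intro boxed_mono[OF _ boxed_power[OF D]] mult_le_mono) (simp_all add: box_def)
    then have "?f i \<in> boxed (CARD('v) * (d * D))"
      unfolding Inl sum.case by (rule boxed_prod)
    then show ?thesis
      by (simp add: N_def n_def)
  next
    case (Inr m)
    then have "m \<in> box a"
      using that by auto
    then have "Poly_Mapping.single m (1 :: 'a) \<in> boxed a"
      by (simp add: boxed_def)
    then show ?thesis
      using e by (simp add: Inr a boxed_mult)
  qed
  then have sub: "?f ` ?I \<subseteq> vs.span ?B"
    using span by blast
  have "card ?B \<le> (N + 1) ^ n"
    using card_image_le[OF finite_box, of "\<lambda>m. Poly_Mapping.single m (1 :: 'a)" N]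
    by (simp add: card_box n_def)
  also have "\<dots> < card ?I"
    using card by (simp add: card_Plus finite_box card_box n_def)
  finally have less: "card ?B < card ?I" .
  obtain c i where c: "i \<in> ?I" "c i \<noteq> 0" "(\<Sum>i\<in>?I. mconst (c i) * ?f i) = 0"
    by (rule vs.dependent_family[OF _ _ sub less]) (auto simp: finite_box)
  define w where "w = (\<Sum>m\<in>box d. Poly_Mapping.single m (c (Inl m)))"
  define h where "h = (\<Sum>m\<in>box a. Poly_Mapping.single m (c (Inr m)))"
  have lookup: "Poly_Mapping.lookup (\<Sum>m\<in>A. Poly_Mapping.single m (b m)) m' = b m'"
    if "m' \<in> A" "finite A" for A and b :: "('v \<Rightarrow>\<^sub>0 nat) \<Rightarrow> 'a" and m'
    using that by (simp add: lookup_sum lookup_single "when_def")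
  have eq: "msubst w F + h * g = 0"
    using c(3)
    by (simp add: w_def h_def msubst_eq_ev ev_sum[OF is_hom_mconst] ev_single[OF is_hom_mconst]
      sum.Plus finite_box sum_distrib_right mconst_def mult_single flip: mult.assoc)
  show ?thesis
  proof
    \<comment> \<open>If \<open>w\<close> vanished, so would \<open>h\<close>, since
      \<open>g\<close> is nonzero; no coefficient \<open>c i\<close> could then be nonzero.\<close>
    show "w \<noteq> 0"
    proof
      assume w: "w = 0"
      then have h: "h = 0"
        using eq assms by (simp add: msubst_hom)
      show False
        using c(1,2) w h lookup[of _ "box d" "\<lambda>m. c (Inl m)"] lookup[of _ "box a" "\<lambda>m. c (Inr m)"]
        by (auto simp: w_def h_def finite_box)
    qed
    have "msubst w F = g * (- h)"
      using eq by (simp add: eq_neg_iff_add_eq_0 mult.commute)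
    then show "g dvd msubst w F" ..
  qed
qed

section \<open>Relations modulo an irreducible polynomial\<close>

lemma polys_in_Int: "p \<in> polys_in A \<Longrightarrow> p \<in> polys_in B \<Longrightarrow> p \<in> polys_in (A \<inter> B)"
  by (auto simp: polys_in_def)

lemma polys_in_Compl_iff: "p \<in> polys_in (- {v}) \<longleftrightarrow> wdeg (\<lambda>u. if u = v then 1 else 0) p = 0"
proof -
  have "(\<lambda>u. if u \<in> - {v} then 0 else 1) = (\<lambda>u. if u = v then 1 else 0 :: nat)"
    by auto
  then show ?thesis
    by (simp add: polys_in_iff_wdeg)
qed

lemma wdeg_insert_le:
  assumes "p \<in> polys_in (insert s T)" "\<And>u. u \<in> T \<Longrightarrow> u \<noteq> s \<Longrightarrow> \<omega> u = 0"
  shows "wdeg \<omega> p \<le> \<omega> s * wdeg (\<lambda>u. if u = s then 1 else 0) p"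
proof (rule wdeg_le)
  fix m assume m: "m \<in> Poly_Mapping.keys p"
  have "\<omega> u * Poly_Mapping.lookup m u = 0" if "u \<noteq> s" for u
  proof (cases "u \<in> T")
    case False
    then have "u \<notin> Poly_Mapping.keys m"
      using assms(1) m that by (auto simp: polys_in_def)
    then show ?thesis
      by (simp add: in_keys_iff)
  qed (simp add: assms(2) that)
  then have "wt \<omega> m = (\<Sum>u\<in>UNIV. if u = s then \<omega> s * Poly_Mapping.lookup m s else 0)"
    unfolding wt_def by (intro sum.cong) auto
  then have "wt \<omega> m = \<omega> s * Poly_Mapping.lookup m s"
    by simp
  also have "\<dots> \<le> \<omega> s * wt (\<lambda>u. if u = s then 1 else 0) m"
    using wt_ge[of "\<lambda>u. if u = s then 1 else 0" s m] by simp
  also have "\<dots> \<le> \<omega> s * wdeg (\<lambda>u. if u = s then 1 else 0) p"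
    using wt_le_wdeg[OF m] by simp
  finally show "wt \<omega> m \<le> \<omega> s * wdeg (\<lambda>u. if u = s then 1 else 0) p" .
qed

lemma all_mpderiv_eq_0:
  fixes p :: "('v::finite, 'a::{idom,ring_char_0}) mpoly"
  assumes "\<And>v. mpderiv v p = 0"
  shows "p = mconst (Poly_Mapping.lookup p 0)"
proof (rule polys_in_empty)
  have "p \<in> polys_in (- {v})" for v
    using assms by (simp add: mpderiv_eq_0_iff)
  then show "p \<in> polys_in {}"
    unfolding polys_in_def by blast
qed

lemma irreducible_not_dvd_mconst:
  fixes g :: "('v::{finite,linorder}, 'a::field) mpoly"
  assumes "irreducible g" "c \<noteq> 0"
  shows "\<not> g dvd mconst c"
proof
  assume "g dvd mconst c"
  then have "g dvd mconst c * mconst (inverse c)"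
    by (rule dvd_mult2)
  then have "g dvd 1"
    using assms(2) by (simp flip: hom_mult[OF is_hom_mconst])
  then show False
    using assms(1) by (simp add: irreducible_def)
qed

lemma irreducible_dvd_prod:
  fixes g :: "('v::{finite,linorder}, 'a::field) mpoly"
  assumes "irreducible g" "g dvd prod f A"
  shows "\<exists>i\<in>A. g dvd f i"
  using assms(2)
proof (induction A rule: infinite_finite_induct)
  case (insert x A)
  then show ?case
    using assms(1) by (auto simp: irreducible_dvd_mult_iff)
qed (use assms(1) in \<open>auto simp: irreducible_def\<close>)

lemma jacobian_nth [simp]: "jacobian F $ i $ j = mpderiv j (F i)"
  by (simp add: jacobian_def)

lemma mpderiv_msubst_jacobian:
  "(\<Sum>i\<in>UNIV. msubst (mpderiv i w) F * jacobian F $ i $ j) = mpderiv j (msubst w F)"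
  by (simp add: mpderiv_msubst)

text \<open>With zero gradient \<open>u\<close> would be a nonzero constant, and no irreducible
  \<open>g\<close> divides that.\<close>

lemma ex_mpderiv_nonzero:
  fixes F :: "'v::{finite,linorder} \<Rightarrow> ('v, 'a::field_char_0) mpoly"
  assumes "irreducible g" "g dvd msubst u F" "u \<noteq> 0"
  obtains v where "mpderiv v u \<noteq> 0"
proof -
  have False if *: "\<And>v. mpderiv v u = 0"
  proof -
    obtain c where c: "u = mconst c"
      using all_mpderiv_eq_0[OF *] by blast
    with assms(3) have "c \<noteq> 0"
      by simp
    from irreducible_not_dvd_mconst[OF assms(1) this] show False
      using assms(2) by (simp add: c msubst_mconst)
  qed
  with that show ?thesis by blast
qed

lemma tdeg_mpderiv_less: "mpderiv v p \<noteq> 0 \<Longrightarrow> wdeg (\<lambda>_. 1) (mpderiv v p) < wdeg (\<lambda>_. 1) p"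
  using wdeg_mpderiv[of v p "\<lambda>_. 1"] by simp

lemma ex_least_wdeg:
  assumes "P (p0 :: ('v::finite, 'a::comm_ring_1) mpoly)"
  obtains p where "P p" "\<And>q. wdeg \<omega> q < wdeg \<omega> p \<Longrightarrow> \<not> P q"
  using ex_has_least_nat[of P p0 "wdeg \<omega>"] assms that by (metis not_le)

text \<open>If \<open>g\<close> does not divide \<open>det JF\<close>, the gradients of the relations between the \<open>F\<^sub>i\<close> modulo \<open>g\<close> are
  all proportional modulo \<open>g\<close>, which leaves no room for a relation not involving \<open>v\<close>.\<close>

lemma irreducible_dvd_jacobian:
  fixes F :: "'v::{finite,linorder} \<Rightarrow> ('v, 'a::field_char_0) mpoly"
  assumes g: "irreducible g" and w: "squarefree w" "g ^ 2 dvd msubst w F"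
  shows "g dvd det (jacobian F)"
proof (rule ccontr)
  assume nd: "\<not> g dvd det (jacobian F)"
  \<comment> \<open>The rows of the Jacobian matrix are linearly independent modulo
    \<open>g\<close>.\<close>
  have independent: "g dvd z k" if "\<And>j. g dvd (\<Sum>i\<in>UNIV. z i * jacobian F $ i $ j)" for z k
    using dvd_det_dependent_rows[OF that, of k] nd irreducible_dvd_mult_iff[OF g] by blast
  have w0: "w \<noteq> 0"
    using w(1) not_squarefree_0 by blast
  have gw: "g dvd msubst w F"
    using w(2) by (simp add: power2_eq_square dvd_mult_left)
  \<comment> \<open>By minimality of the degree, no nonzero partial derivative of \<open>u\<close>
    is again a relation.\<close>
  obtain u where u: "u \<noteq> 0 \<and> g dvd msubst u F"
    and u_min: "\<And>x. wdeg (\<lambda>_. 1) x < wdeg (\<lambda>_. 1) u \<Longrightarrow> \<not> (x \<noteq> 0 \<and> g dvd msubst x F)"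
    using ex_least_wdeg[of "\<lambda>x. x \<noteq> 0 \<and> g dvd msubst x F" w "\<lambda>_. 1"] w0 gw by blast
  then obtain v where v: "mpderiv v u \<noteq> 0"
    using ex_mpderiv_nonzero[OF g] by blast
  have not_dvd_v: "\<not> g dvd msubst (mpderiv v u) F"
    using u_min[OF tdeg_mpderiv_less[OF v]] v by blast
  obtain h1 where h1: "msubst u F = g * h1"
    using u by (auto elim: dvdE)
  have no_free: "\<not> g dvd msubst t0 F" if t0: "t0 \<noteq> 0" "t0 \<in> polys_in (- {v})" for t0
  proof
    assume "g dvd msubst t0 F"
    then obtain t where t: "t \<noteq> 0 \<and> t \<in> polys_in (- {v}) \<and> g dvd msubst t F"
      and t_min: "\<And>x. wdeg (\<lambda>_. 1) x < wdeg (\<lambda>_. 1) t \<Longrightarrow> \<not> (x \<noteq> 0 \<and> x \<in> polys_in (- {v}) \<and> g dvd msubst x F)"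
      using ex_least_wdeg[of "\<lambda>x. x \<noteq> 0 \<and> x \<in> polys_in (- {v}) \<and> g dvd msubst x F" t0 "\<lambda>_. 1"] t0 by blast
    obtain s where s: "mpderiv s t \<noteq> 0"
      using ex_mpderiv_nonzero[OF g] t by blast
    have not_dvd_s: "\<not> g dvd msubst (mpderiv s t) F"
      using t_min[OF tdeg_mpderiv_less[OF s]] s t polys_in_mpderiv[of t "- {v}" s] by simp
    obtain h2 where h2: "msubst t F = g * h2"
      using t by (auto elim: dvdE)
    \<comment> \<open>Modulo \<open>g\<close> the gradients of \<open>u(F)\<close> and
      \<open>t(F)\<close> are \<open>h1\<close> and \<open>h2\<close> times that of
      \<open>g\<close>; this combination cancels them.\<close>
    define z where "z i = h2 * msubst (mpderiv i u) F - h1 * msubst (mpderiv i t) F" for i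
    have "(\<Sum>i\<in>UNIV. z i * jacobian F $ i $ j) =
        h2 * mpderiv j (msubst u F) - h1 * mpderiv j (msubst t F)" for j
      by (simp only: z_def left_diff_distrib sum_subtractf mult.assoc sum_distrib_left[symmetric] mpderiv_msubst_jacobian)
    also have "h2 * mpderiv j (msubst u F) - h1 * mpderiv j (msubst t F) =
        g * (h2 * mpderiv j h1 - h1 * mpderiv j h2)" for j
      by (simp add: h1 h2 mpderiv_mult algebra_simps)
    finally have z: "g dvd (\<Sum>i\<in>UNIV. z i * jacobian F $ i $ j)" for j
      by simp
    \<comment> \<open>As \<open>t\<close> does not involve \<open>v\<close>, this component is
      \<open>h2\<close> times the value at \<open>F\<close> of the derivative of \<open>u\<close>,
      which \<open>g\<close> does not divide.\<close>
    have "g dvd z v"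
      by (rule independent[OF z])
    moreover have "mpderiv v t = 0"
      using t by (simp add: mpderiv_eq_0_iff)
    ultimately have "g dvd h2"
      using not_dvd_v g by (simp add: z_def msubst_hom irreducible_dvd_mult_iff)
    then have "g dvd mpderiv j (msubst t F)" for j
      by (simp add: h2 mpderiv_mult)
    then have "g dvd msubst (mpderiv s t) F"
      using independent[of "\<lambda>i. msubst (mpderiv i t) F" s] by (simp only: mpderiv_msubst_jacobian)
    then show False
      using not_dvd_s by simp
  qed
  obtain c r s where c: "c \<noteq> 0" "c \<in> polys_in (- {v})" "c = r * w + s * mpderiv v w"
    using squarefree_bezout_mpderiv[OF w(1)] by blast
  obtain h where h: "msubst w F = g ^ 2 * h"
    using w(2) ..
  \<comment> \<open>The square of \<open>g\<close> leaves a factor \<open>g\<close> in the gradient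
    of \<open>w(F)\<close>, so the derivative of \<open>w\<close> is a relation, and then so is the
    \<open>v\<close>-free combination \<open>c\<close>.\<close>
  have "g dvd mpderiv j (msubst w F)" for j
    by (simp add: h mpderiv_mult power2_eq_square)
  then have "g dvd msubst (mpderiv v w) F"
    using independent[of "\<lambda>i. msubst (mpderiv i w) F" v] by (simp only: mpderiv_msubst_jacobian)
  then have "g dvd msubst c F"
    using gw by (simp add: c(3) msubst_hom)
  then show False
    using no_free[OF c(1,2)] by simp
qed

text \<open>Here the \<open>F\<^sub>i\<close> with \<open>i \<noteq> v\<close> are algebraically independent modulo \<open>g\<close>, so every coordinate is
  algebraic over them. Differentiating the corresponding relations shows that the gradient of \<open>g\<close>
  completes their gradients to a basis modulo \<open>g\<close>.\<close>

lemma irreducible_square_dvd_corank_1: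
  fixes F :: "'v::{finite,linorder} \<Rightarrow> ('v, 'a::field_char_0) mpoly"
  assumes g: "irreducible g" and det: "g dvd det (jacobian F)"
    and free: "\<And>p. p \<in> polys_in (- {v}) \<Longrightarrow> g dvd msubst p F \<Longrightarrow> p = 0"
    and w: "g dvd msubst w F"
  shows "g ^ 2 dvd msubst w F"
proof -
  \<comment> \<open>Slot \<open>v\<close> now holds the coordinate \<open>x j\<close>, so a relation
    for \<open>F' j\<close> expresses that \<open>x j\<close> is algebraic modulo \<open>g\<close>
    over the remaining components.\<close>
  define F' where "F' j = F(v := mvar j)" for j
  have g0: "g \<noteq> 0"
    using g by auto
  have "\<exists>A h. msubst A (F' j) = g * h \<and> \<not> g dvd msubst (mpderiv v A) (F' j)" for j
  proof -
    obtain A0 where "A0 \<noteq> 0" "g dvd msubst A0 (F' j)"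
      using ex_msubst_dvd[OF g0] by blast
    then obtain A where A: "A \<noteq> 0 \<and> g dvd msubst A (F' j)"
      and A_min: "\<And>x. wdeg (\<lambda>_. 1) x < wdeg (\<lambda>_. 1) A \<Longrightarrow> \<not> (x \<noteq> 0 \<and> g dvd msubst x (F' j))"
      using ex_least_wdeg[of "\<lambda>x. x \<noteq> 0 \<and> g dvd msubst x (F' j)" A0 "\<lambda>_. 1"] by blast
    \<comment> \<open>Without \<open>v\<close>, \<open>A\<close> would be a relation among the
      independent components of \<open>F\<close>.\<close>
    have "mpderiv v A \<noteq> 0"
    proof
      assume "mpderiv v A = 0"
      then have A_free: "A \<in> polys_in (- {v})"
        by (simp add: mpderiv_eq_0_iff)
      have "msubst A (F' j) = msubst A F"
        unfolding msubst_eq_ev by (rule ev_cong_polys_in[OF A_free]) (simp add: F'_def)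
      then show False
        using free[OF A_free] A by simp
    qed
    then have "\<not> g dvd msubst (mpderiv v A) (F' j)"
      using A_min[OF tdeg_mpderiv_less] by blast
    moreover obtain h where "msubst A (F' j) = g * h"
      using A by (auto elim: dvdE)
    ultimately show ?thesis by blast
  qed
  then obtain A h where A: "\<And>j. msubst (A j) (F' j) = g * h j"
    and a: "\<And>j. \<not> g dvd msubst (mpderiv v (A j)) (F' j)"
    by metis
  \<comment> \<open>\<open>M\<close> is the Jacobian matrix with the gradient of \<open>g\<close> as
    row \<open>v\<close>. Differentiating the relations \<open>A j\<close> gives
    \<open>B ** M\<close> congruent to the diagonal matrix \<open>D\<close> modulo \<open>g\<close>,
    whose diagonal entries \<open>g\<close> does not divide.\<close>
  define M where "M = (\<chi> i. if i = v then (\<chi> k. mpderiv k g) else jacobian F $ i)"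
  define B where "B = (\<chi> j i. if i = v then h j else - msubst (mpderiv i (A j)) (F' j))"
  define D where "D = (\<chi> j k. if j = k then msubst (mpderiv v (A j)) (F' j) else 0)"
  have BM: "(B ** M) $ j $ k - D $ j $ k = g * (- mpderiv k (h j))" for j k
  proof -
    let ?c = "\<lambda>i. msubst (mpderiv i (A j)) (F' j)"
    let ?S = "\<Sum>i\<in>UNIV - {v}. ?c i * mpderiv k (F i)"
    have "mpderiv k (msubst (A j) (F' j)) = ?c v * mpderiv k (mvar j) + ?S"
      unfolding mpderiv_msubst by (subst sum.remove[of _ v]) (auto simp: F'_def intro!: sum.cong)
    then have "D $ j $ k + ?S = mpderiv k g * h j + g * mpderiv k (h j)"
      by (simp add: A D_def mpderiv_mvar mpderiv_mult)
    moreover have "(B ** M) $ j $ k = h j * mpderiv k g - ?S"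
      unfolding matrix_matrix_mult_def vec_lambda_beta
      by (subst sum.remove[of _ v]) (auto simp: B_def M_def sum_negf[symmetric] intro!: sum.cong)
    ultimately show ?thesis
      by algebra
  qed
  have "\<not> g dvd det M"
  proof
    assume "g dvd det M"
    then have "g dvd det (B ** M)"
      by (simp add: det_mul)
    moreover have "g dvd det (B ** M) - det D"
      by (rule det_cong_dvd) (simp only: BM dvd_triv_left)
    ultimately have "g dvd det (B ** M) - (det (B ** M) - det D)"
      by (rule dvd_diff)
    moreover have "det D = (\<Prod>j\<in>UNIV. msubst (mpderiv v (A j)) (F' j))"
      by (subst det_diagonal) (simp_all add: D_def)
    ultimately have "g dvd (\<Prod>j\<in>UNIV. msubst (mpderiv v (A j)) (F' j))"
      by simp
    from irreducible_dvd_prod[OF g this] show False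
      using a by simp
  qed
  obtain q where q: "msubst w F = g * q"
    using w ..
  \<comment> \<open>Row \<open>v\<close> is replaced by the gradient of \<open>w(F)\<close>: as a
    combination of rows this gives a multiple of the Jacobian determinant, while modulo
    \<open>g\<close> it gives \<open>q * det M\<close>.\<close>
  let ?N = "\<chi> i. if i = v then (\<Sum>l\<in>UNIV. msubst (mpderiv l w) F *s jacobian F $ l) else jacobian F $ i"
  let ?N' = "\<chi> i. if i = v then q *s (\<chi> k. mpderiv k g) else jacobian F $ i"
  have "?N $ i $ j - ?N' $ i $ j = (if i = v then g * mpderiv j q else 0)" for i j
    using mpderiv_msubst_jacobian[of w F j] by (simp add: q mpderiv_mult)
  then have "g dvd det ?N - det ?N'"
    by (intro det_cong_dvd) simp
  then have "g dvd q * det M"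
    using det by (simp add: det_replace_row det_row_mul M_def dvd_diff_right_iff)
  then have "g dvd q"
    using \<open>\<not> g dvd det M\<close> g by (simp add: irreducible_dvd_mult_iff)
  then show ?thesis
    by (simp add: q power2_eq_square)
qed

text \<open>Here there are relations \<open>p\<close> and \<open>q\<close> that involve, besides variables in \<open>T\<close>, only \<open>s\<close> resp. \<open>t\<close>.
  The polynomial \<open>s\<^sup>a p\<^sup>2 + t\<^sup>b q\<^sup>2\<close>, with degrees in \<open>s\<close> and \<open>t\<close> coprime, is irreducible up
  to a factor in the variables of \<open>T\<close>: any factorization is constrained by the Newton segment
  between the corresponding two exponents, which contains no other lattice point.\<close>

lemma irreducible_square_dvd_corank_2:
  fixes F :: "'v::{finite,linorder} \<Rightarrow> ('v, 'a::field_char_0) mpoly"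
  assumes g: "irreducible g"
    and free: "\<And>p. p \<in> polys_in T \<Longrightarrow> g dvd msubst p F \<Longrightarrow> p = 0"
    and st: "s \<notin> T" "t \<notin> T" "s \<noteq> t"
    and p: "p \<in> polys_in (insert s T)" "p \<noteq> 0" "g dvd msubst p F"
    and q: "q \<in> polys_in (insert t T)" "q \<noteq> 0" "g dvd msubst q F"
  shows "\<exists>w. irreducible w \<and> g ^ 2 dvd msubst w F"
proof -
  let ?ds = "wdeg (\<lambda>u. if u = s then 1 else 0) :: ('v, 'a) mpoly \<Rightarrow> nat"
  let ?dt = "wdeg (\<lambda>u. if u = t then 1 else 0) :: ('v, 'a) mpoly \<Rightarrow> nat"
  have mvar0: "mvar v ^ k \<noteq> (0 :: ('v, 'a) mpoly)" for v k
    by (metis keys_eq_empty keys_single mvar_power singleton_insert_inj_eq zero_neq_one insert_not_empty)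
  define \<alpha> where "\<alpha> = ?ds p"
  define \<beta> where "\<beta> = ?dt q"
  have "\<alpha> > 0"
  proof (rule ccontr)
    assume "\<not> \<alpha> > 0"
    then have "p \<in> polys_in (insert s T \<inter> - {s})"
      using p(1) by (intro polys_in_Int) (simp_all add: \<alpha>_def polys_in_Compl_iff)
    moreover have "insert s T \<inter> - {s} = T"
      using st by auto
    ultimately show False
      using free p by auto
  qed
  \<comment> \<open>These exponents give \<open>f\<close> degree
    \<open>A = 2 * \<alpha> + 2 * \<beta>\<close> in \<open>s\<close> and \<open>A + 1\<close> in
    \<open>t\<close>, which are coprime.\<close>
  define a where "a = 2 * \<beta>"
  define b where "b = 2 * \<alpha> + 1"
  define A where "A = a + 2 * \<alpha>"
  define B where "B = b + 2 * \<beta>"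
  have AB: "A > 0" "B = A + 1"
    using \<open>\<alpha> > 0\<close> by (simp_all add: A_def B_def a_def b_def)
  \<comment> \<open>For this weight \<open>s ^ A\<close> and \<open>t ^ B\<close> both have weight
    \<open>A * B\<close>, the maximum over \<open>f\<close>.\<close>
  let ?\<omega> = "\<lambda>u. if u = s then B else if u = t then A else 0"
  define f1 where "f1 = mvar s ^ a * p ^ 2"
  define f2 where "f2 = mvar t ^ b * q ^ 2"
  define f where "f = f1 + f2"
  have nz: "f1 \<noteq> 0" "f2 \<noteq> 0"
    using mvar0 p q by (simp_all add: f1_def f2_def)
  have deg1: "wdeg \<omega> f1 = \<omega> s * a + 2 * wdeg \<omega> p" for \<omega>
    using p mvar0 by (simp add: f1_def wdeg_mult wdeg_power wdeg_mvar_power)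
  have deg2: "wdeg \<omega> f2 = \<omega> t * b + 2 * wdeg \<omega> q" for \<omega>
    using q mvar0 by (simp add: f2_def wdeg_mult wdeg_power wdeg_mvar_power)
  have "q \<in> polys_in (- {s})" "p \<in> polys_in (- {t})"
    using p(1) q(1) st polys_in_mono[of "insert t T" "- {s}"] polys_in_mono[of "insert s T" "- {t}"] by auto
  then have "?ds q = 0" "?dt p = 0"
    by (simp_all add: polys_in_Compl_iff)
  then have ds: "?ds f1 = A" "?ds f2 = 0" and dt: "?dt f1 = 0" "?dt f2 = B"
    using st by (auto simp: deg1 deg2 A_def B_def \<alpha>_def \<beta>_def)
  have ds_f: "?ds f = A"
    using ds AB wdeg_add_eq_left[of _ f2 f1] by (simp add: f_def)
  have dt_f: "?dt f = B"
    using dt AB wdeg_add_eq_left[of _ f1 f2] by (simp add: f_def add.commute)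
  have f0: "f \<noteq> 0"
    using ds_f AB by auto
  have "wdeg ?\<omega> p \<le> ?\<omega> s * ?ds p"
    by (rule wdeg_insert_le[OF p(1)]) (use st in auto)
  then have "wdeg ?\<omega> p \<le> B * \<alpha>"
    by (simp add: \<alpha>_def)
  then have "wdeg ?\<omega> f1 \<le> B * A"
    by (simp add: deg1 A_def algebra_simps)
  moreover have "wdeg ?\<omega> q \<le> ?\<omega> t * ?dt q"
    by (rule wdeg_insert_le[OF q(1)]) (use st in auto)
  then have "wdeg ?\<omega> q \<le> A * \<beta>"
    using st(3) by (simp add: \<beta>_def)
  then have "wdeg ?\<omega> f2 \<le> B * A"
    using st(3) by (simp add: deg2 B_def algebra_simps)
  ultimately have le_f: "wdeg ?\<omega> f \<le> B * A"
    using wdeg_add_le[of ?\<omega> f1 f2] by (simp add: f_def)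
  have ge_s: "B * ?ds x \<le> wdeg ?\<omega> x" and ge_t: "A * ?dt x \<le> wdeg ?\<omega> x" for x :: "('v, 'a) mpoly"
    using st(3) by (auto intro!: mult_wdeg_indicator_le)
  have "wdeg ?\<omega> f > 0"
    using ge_s[of f] AB by (simp add: ds_f)
  then obtain w where w: "irreducible w" "w dvd f" "wdeg ?\<omega> w > 0"
    by (rule ex_irreducible_factor)
  obtain c where c: "f = w * c"
    using w(2) ..
  have wc: "w \<noteq> 0" "c \<noteq> 0"
    using f0 c by auto
  have sums: "?ds w + ?ds c = A" "?dt w + ?dt c = B" "wdeg ?\<omega> w + wdeg ?\<omega> c \<le> B * A"
    using ds_f dt_f le_f by (simp_all add: c wdeg_mult wc)
  \<comment> \<open>The weighted degree of each factor is at least \<open>B\<close> times its degree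
    in \<open>s\<close> and \<open>A\<close> times that in \<open>t\<close>. The totals leave no
    slack, so equality holds for \<open>w\<close>.\<close>
  have "B * ?ds w + B * ?ds c = B * A" "A * ?dt w + A * ?dt c = B * A"
    using sums by (simp_all flip: add_mult_distrib2 add: mult.commute)
  then have eq: "wdeg ?\<omega> w = B * ?ds w" "wdeg ?\<omega> w = A * ?dt w"
    using sums(3) ge_s[of w] ge_s[of c] ge_t[of w] ge_t[of c] by linarith+
  \<comment> \<open>Coprimality makes \<open>A\<close> divide the degree of \<open>w\<close> in
    \<open>s\<close>, which is positive and at most \<open>A\<close>; thus \<open>w\<close> takes up
    the whole degree.\<close>
  then have "A dvd B * ?ds w"
    by (metis dvd_triv_left)
  moreover have "coprime A B"
    unfolding AB(2) by simp
  ultimately have "A dvd ?ds w"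
    by (simp add: coprime_dvd_mult_right_iff)
  moreover have "?ds w > 0"
    using w(3) eq(1) by (auto intro: Nat.gr0I)
  ultimately have "?ds w = A"
    using sums(1) by (auto dest: dvd_imp_le)
  then have "?ds c = 0" "wdeg ?\<omega> w = B * A"
    using sums(1) eq(1) by simp_all
  moreover from this have "?dt c = 0"
    using sums(3) ge_t[of c] AB by simp
  ultimately have "c \<in> polys_in (- {s} \<inter> - {t})"
    by (intro polys_in_Int) (simp_all add: polys_in_Compl_iff)
  moreover have "f \<in> polys_in (insert s (insert t T))"
    unfolding f_def f1_def f2_def
    using p(1) q(1) polys_in_mono[of "insert t T" "insert s (insert t T)"] polys_in_mono[of "insert s T" "insert s (insert t T)"]
    by (intro polys_in_add polys_in_mult polys_in_power) auto
  then have "c \<in> polys_in (insert s (insert t T))"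
    by (rule polys_in_dvd[rotated 2]) (simp_all add: c wc)
  ultimately have "c \<in> polys_in ((- {s} \<inter> - {t}) \<inter> insert s (insert t T))"
    by (rule polys_in_Int)
  moreover have "(- {s} \<inter> - {t}) \<inter> insert s (insert t T) = T"
    using st by auto
  ultimately have nd: "\<not> g dvd msubst c F"
    using free wc(2) by auto
  \<comment> \<open>This is why \<open>p\<close> and \<open>q\<close> enter squared; the cofactor
    \<open>c\<close> lies in \<open>K[T]\<close> and can be cancelled.\<close>
  have "g ^ 2 dvd msubst f F"
    using p(3) q(3) by (simp add: f_def f1_def f2_def msubst_hom dvd_power_same)
  then have "g ^ 2 dvd msubst c F * msubst w F"
    by (simp add: c msubst_hom mult.commute)
  then have "g ^ 2 dvd msubst w F"
    by (rule irreducible_power2_dvd_mult[OF g nd])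
  with w(1) show ?thesis by blast
qed

lemma ex_irreducible_square_dvd:
  fixes F :: "'v::{finite,linorder} \<Rightarrow> ('v, 'a::field_char_0) mpoly"
  assumes g: "irreducible g" and det: "g dvd det (jacobian F)"
  shows "\<exists>w. irreducible w \<and> g ^ 2 dvd msubst w F"
proof -
  have g0: "g \<noteq> 0"
    using g by auto
  \<comment> \<open>The sets of indices whose components of \<open>F\<close> are algebraically
    independent modulo \<open>g\<close>.\<close>
  define Ind where "Ind = {T. \<forall>p\<in>polys_in T. g dvd msubst p F \<longrightarrow> p = 0}"
  have "{} \<in> Ind"
    unfolding Ind_def
  proof safe
    fix p assume p: "p \<in> polys_in {}" "g dvd msubst p F"
    then obtain c where "p = mconst c"
      using polys_in_empty by blast
    then show "p = 0"
      using p(2) irreducible_not_dvd_mconst[OF g, of c] by (auto simp: msubst_mconst)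
  qed
  then obtain T where T: "T \<in> Ind" and max: "\<And>T'. T' \<in> Ind \<Longrightarrow> T \<subseteq> T' \<Longrightarrow> T = T'"
    using finite_has_maximal[of Ind] by auto
  have free: "p = 0" if "p \<in> polys_in T" "g dvd msubst p F" for p
    using T that by (auto simp: Ind_def)
  have dep: "\<exists>p. p \<in> polys_in (insert s T) \<and> p \<noteq> 0 \<and> g dvd msubst p F" if "s \<notin> T" for s
    using max[of "insert s T"] that by (auto simp: Ind_def)
  obtain w0 where w0: "w0 \<noteq> 0" "g dvd msubst w0 F"
    using ex_msubst_dvd[OF g0] by blast
  then have "T \<noteq> UNIV"
    using free by auto
  then obtain s where s: "s \<notin> T" by auto
  show ?thesis
  proof (cases "\<exists>t. t \<notin> T \<and> t \<noteq> s")
    case True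
    then obtain t where "t \<notin> T" "s \<noteq> t" by blast
    with dep[OF s] dep[OF this(1)] s show ?thesis
      using irreducible_square_dvd_corank_2[OF g free] by blast
  next
    case False
    then have T_eq: "T = - {s}"
      using s by auto
    obtain w where w: "w \<noteq> 0 \<and> g dvd msubst w F"
      and w_min: "\<And>x. wdeg (\<lambda>_. 1) x < wdeg (\<lambda>_. 1) w \<Longrightarrow> \<not> (x \<noteq> 0 \<and> g dvd msubst x F)"
      using ex_least_wdeg[of "\<lambda>x. x \<noteq> 0 \<and> g dvd msubst x F" w0 "\<lambda>_. 1"] w0 by blast
    \<comment> \<open>A relation of least degree is irreducible because the relations form a proper
      prime ideal.\<close>
    have "irreducible w"
    proof (rule irreducibleI)
      show "\<not> w dvd 1"
      proof
        assume "w dvd 1"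
        then have "msubst w F dvd msubst 1 F"
          by (rule hom_dvd[OF is_hom_msubst])
        then have "g dvd 1"
          using w by (auto simp: msubst_hom intro: dvd_trans)
        then show False
          using g by (simp add: irreducible_def)
      qed
    next
      fix a b assume ab: "w = a * b"
      then have nz: "a \<noteq> 0" "b \<noteq> 0"
        using w by auto
      have "g dvd msubst a F \<or> g dvd msubst b F"
        using w g by (simp add: ab msubst_hom irreducible_dvd_mult_iff)
      then have "\<not> wdeg (\<lambda>_. 1) a < wdeg (\<lambda>_. 1) w \<or> \<not> wdeg (\<lambda>_. 1) b < wdeg (\<lambda>_. 1) w"
        using w_min nz by blast
      then show "a dvd 1 \<or> b dvd 1"
        using nz by (auto simp: ab wdeg_mult is_unit_mpoly_iff)
    qed (use w in simp)
    moreover have "g ^ 2 dvd msubst w F"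
      using irreducible_square_dvd_corank_1[OF g det] free w unfolding T_eq by blast
    ultimately show ?thesis by blast
  qed
qed

text \<open>The irreducible polynomials found for the factors of \<open>g\<close> are multiplied
  together, each new one only if it does not already divide the product.\<close>

lemma ex_squarefree_square_dvd:
  fixes F :: "'v::{finite,linorder} \<Rightarrow> ('v, 'a::field) mpoly"
  assumes "squarefree g" "\<And>f. irreducible f \<Longrightarrow> f dvd g \<Longrightarrow> \<exists>w :: ('v, 'a) mpoly. irreducible w \<and> f ^ 2 dvd msubst w F"
  shows "\<exists>w :: ('v, 'a) mpoly. squarefree w \<and> g ^ 2 dvd msubst w F"
  using assms
proof (induction g rule: squarefree_mpoly_induct)
  case (unit u)
  have "squarefree (1 :: ('v, 'a) mpoly)"
    by (auto intro!: squarefreeI simp: power2_eq_square dest: dvd_mult_left)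
  moreover have "u ^ 2 dvd msubst 1 F"
    using mult_dvd_mono[OF \<open>u dvd 1\<close> \<open>u dvd 1\<close>] by (simp add: msubst_hom power2_eq_square)
  ultimately show ?case by blast
next
  case (mult f g)
  then obtain w' :: "('v, 'a) mpoly" where w': "squarefree w'" "g ^ 2 dvd msubst w' F"
    using dvd_mult by blast
  obtain w :: "('v, 'a) mpoly" where w: "irreducible w" "f ^ 2 dvd msubst w F"
    using mult.prems[OF mult.hyps(1) dvd_triv_left] by blast
  show ?case
  proof (cases "w dvd w'")
    \<comment> \<open>Here \<open>w'\<close> already works: the square of \<open>f\<close> divides
      \<open>w'(F)\<close> and is prime to that of \<open>g\<close>.\<close>
    case True
    then have "msubst w F dvd msubst w' F"
      by (rule hom_dvd[OF is_hom_msubst])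
    then have f2: "f ^ 2 dvd msubst w' F"
      using w(2) by (rule dvd_trans[rotated])
    obtain h where h: "msubst w' F = g ^ 2 * h"
      using w'(2) ..
    have "\<not> f dvd g ^ 2"
      using mult.hyps by (simp add: power2_eq_square irreducible_dvd_mult_iff)
    then have "f ^ 2 dvd h"
      using irreducible_power2_dvd_mult[OF mult.hyps(1)] f2 unfolding h by blast
    then have "(f * g) ^ 2 dvd msubst w' F"
      unfolding h power_mult_distrib mult.commute[of "f ^ 2"] by (rule mult_dvd_mono[OF dvd_refl])
    then show ?thesis
      using w'(1) by blast
  next
    case False
    then have "squarefree (w * w')"
      using w(1) w'(1) by (intro squarefree_mult_irreducible_iff)
    moreover have "(f * g) ^ 2 dvd msubst (w * w') F"
      using w(2) w'(2) by (simp add: power_mult_distrib msubst_hom mult_dvd_mono)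
    ultimately show ?thesis by blast
  qed
qed

text \<open>The three statements are proved in a cycle; the last implication is checked on each
  irreducible divisor of \<open>g\<close>.\<close>

lemma squarefree_dvd_jacobian_iff:
  fixes F :: "'v::{finite,linorder} \<Rightarrow> ('v, 'a::field_char_0) mpoly"
  assumes "squarefree g"
  shows "(g dvd det (jacobian F) \<longleftrightarrow> (\<forall>gt. irreducible gt \<and> gt dvd g \<longrightarrow>
             (\<exists>wt :: ('v, 'a) mpoly. irreducible wt \<and> gt ^ 2 dvd msubst wt F)))
       \<and> (g dvd det (jacobian F) \<longleftrightarrow> (\<exists>w :: ('v, 'a) mpoly. squarefree w \<and> g ^ 2 dvd msubst w F))"
    (is "(?A \<longleftrightarrow> ?B) \<and> (?A \<longleftrightarrow> ?C)")
proof -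
  have "?B" if "?A"
    using that ex_irreducible_square_dvd dvd_trans by blast
  moreover have "?C" if "?B"
    using that by (intro ex_squarefree_square_dvd assms) blast
  moreover have "?A" if "?C"
  proof -
    from that obtain w :: "('v, 'a) mpoly" where w: "squarefree w" "g ^ 2 dvd msubst w F"
      by blast
    have "f dvd det (jacobian F)" if "irreducible f" "f dvd g" for f
      using irreducible_dvd_jacobian[OF that(1) w(1)] w(2) that(2) by (meson dvd_power_same dvd_trans)
    then show ?thesis
      using squarefree_dvd_iff[OF assms] by blast
  qed
  ultimately show ?thesis by blast
qed

section \<open>Passing to an ordered type of variables\<close>

text \<open>Conjugation by \<open>e\<close> is a sign-preserving bijection between the permutations
  in the two Leibniz sums.\<close>

lemma det_reindex:
  fixes A :: "'a::comm_ring_1 ^ 'u::finite ^ 'u" and e :: "'v::finite \<Rightarrow> 'u"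
  assumes "bij e"
  shows "det (\<chi> i j. A $ e i $ e j) = det A"
  unfolding det_def
proof (rule sum.reindex_bij_witness[where i = "map_permutation UNIV (inv e)" and j = "map_permutation UNIV e"])
  have e: "inj e" "surj e" "bij (inv e)"
    using assms bij_imp_bij_inv[of e] by (simp_all add: bij_is_inj bij_is_surj)
  {
    fix \<pi> :: "'v \<Rightarrow> 'v" assume "\<pi> \<in> {\<pi>. \<pi> permutes UNIV}"
    then have \<pi>: "\<pi> permutes UNIV" by simp
    show "map_permutation UNIV (inv e) (map_permutation UNIV e \<pi>) = \<pi>"
      using assms \<pi> e by (intro map_permutation_compose_inv) simp_all
    show "map_permutation UNIV e \<pi> \<in> {\<pi>. \<pi> permutes UNIV}"
      using map_permutation_permutes[OF assms \<pi>] by simp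
    have "(\<Prod>i\<in>UNIV. A $ i $ map_permutation UNIV e \<pi> i) = (\<Prod>i\<in>UNIV. A $ e i $ map_permutation UNIV e \<pi> (e i))"
      by (rule prod.reindex_bij_betw[OF assms, symmetric])
    then show "of_int (sign (map_permutation UNIV e \<pi>)) * (\<Prod>i\<in>UNIV. A $ i $ map_permutation UNIV e \<pi> i) =
        of_int (sign \<pi>) * (\<Prod>i\<in>UNIV. (\<chi> i j. A $ e i $ e j) $ i $ \<pi> i)"
      using sign_map_permutation[OF e(1) \<pi>] by (simp add: map_permutation_apply[OF e(1)])
  next
    fix \<pi> :: "'u \<Rightarrow> 'u" assume "\<pi> \<in> {\<pi>. \<pi> permutes UNIV}"
    then have \<pi>: "\<pi> permutes UNIV" by simp
    show "map_permutation UNIV e (map_permutation UNIV (inv e) \<pi>) = \<pi>"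
      using \<pi> e by (intro map_permutation_compose_inv) (simp_all add: surj_f_inv_f)
    show "map_permutation UNIV (inv e) \<pi> \<in> {\<pi>. \<pi> permutes UNIV}"
      using map_permutation_permutes[OF e(3) \<pi>] by simp
  }
qed

text \<open>An arbitrary finite type of variables carries no order, whereas the library provides the
  integral domain structure on polynomials only for ordered monomials. The following copy of a
  finite type is equipped with an arbitrary linear order.\<close>

typedef 'v ordered_copy = "UNIV :: 'v set" ..

definition ordered_copy_rank :: "'v::finite ordered_copy \<Rightarrow> nat" where
  "ordered_copy_rank x = (SOME f. inj f) (Rep_ordered_copy x)"

lemma inj_ordered_copy_rank: "inj ordered_copy_rank"
proof -
  have "\<exists>f :: 'a \<Rightarrow> nat. inj f"
    using finite_imp_inj_to_nat_seg[of "UNIV :: 'a set"] by auto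
  then have "inj (SOME f :: 'a \<Rightarrow> nat. inj f)"
    by (rule someI_ex)
  then show ?thesis
    unfolding ordered_copy_rank_def inj_def Rep_ordered_copy_inject[symmetric] by blast
qed

lemma bij_Abs_ordered_copy: "bij Abs_ordered_copy"
  by (rule bij_betw_byWitness[where f' = Rep_ordered_copy])
     (simp_all add: Abs_ordered_copy_inverse Rep_ordered_copy_inverse)

instance ordered_copy :: (finite) finite
proof
  have "finite (range (Abs_ordered_copy :: 'a \<Rightarrow> _))"
    by simp
  then show "finite (UNIV :: 'a ordered_copy set)"
    by (simp only: bij_is_surj[OF bij_Abs_ordered_copy])
qed

instantiation ordered_copy :: (finite) linorder
begin

definition "x \<le> y \<longleftrightarrow> ordered_copy_rank x \<le> ordered_copy_rank y"
definition "x < y \<longleftrightarrow> ordered_copy_rank x < ordered_copy_rank y"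

instance
  by standard
     (auto simp: less_eq_ordered_copy_def less_ordered_copy_def dest: injD[OF inj_ordered_copy_rank])

end

section \<open>Transport along ring isomorphisms\<close>

context
  fixes f :: "'a::comm_ring_1 \<Rightarrow> 'b::comm_ring_1" and g
  assumes f: "is_hom f" and g: "is_hom g" and gf: "\<And>x. g (f x) = x" and fg: "\<And>y. f (g y) = y"
begin

lemma iso_dvd_iff: "f x dvd f y \<longleftrightarrow> x dvd y"
  using hom_dvd[OF f, of x y] hom_dvd[OF g, of "f x" "f y"] by (auto simp: gf)

lemma iso_irreducible: "irreducible x \<Longrightarrow> irreducible (f x)"
proof (rule irreducibleI)
  assume x: "irreducible x"
  show "f x \<noteq> 0"
    using x gf[of x] hom_0[OF g] by (auto simp: irreducible_def)
  show "\<not> f x dvd 1"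
    using x iso_dvd_iff[of x 1] by (simp add: irreducible_def hom_1[OF f])
  fix a b assume "f x = a * b"
  then have "x = g a * g b"
    by (metis gf hom_mult[OF g])
  then have "g a dvd 1 \<or> g b dvd 1"
    by (rule irreducibleD[OF x])
  then show "a dvd 1 \<or> b dvd 1"
    using hom_dvd[OF f, of "g a" 1] hom_dvd[OF f, of "g b" 1] by (auto simp: fg hom_1[OF f])
qed

lemma iso_squarefree: "squarefree x \<Longrightarrow> squarefree (f x)"
proof (rule squarefreeI)
  fix y assume x: "squarefree x" and y: "y ^ 2 dvd f x"
  then have "g y ^ 2 dvd x"
    using hom_dvd[OF g y] by (simp add: gf hom_power[OF g])
  then have "g y dvd 1"
    by (rule squarefreeD[OF x])
  then show "y dvd 1"
    using hom_dvd[OF f, of "g y" 1] by (simp add: fg hom_1[OF f])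
qed

end

section \<open>Renaming of variables\<close>

definition rename :: "('v \<Rightarrow> 'u) \<Rightarrow> ('v::finite, 'a::comm_ring_1) mpoly \<Rightarrow> ('u, 'a) mpoly" where
  "rename e p = msubst p (\<lambda>v. mvar (e v))"

lemma is_hom_rename: "is_hom (rename e)"
  unfolding rename_def[abs_def] by (rule is_hom_msubst)

lemma rename_mvar: "rename e (mvar v) = mvar (e v)" and rename_mconst: "rename e (mconst c) = mconst c"
  by (simp_all add: rename_def msubst_mvar msubst_mconst)

lemma rename_inverse:
  fixes p :: "('v::finite, 'a::comm_ring_1) mpoly" and e :: "'v \<Rightarrow> 'u::finite"
  assumes "\<And>v. e' (e v) = v"
  shows "rename e' (rename e p) = p"
  by (rule hom_eqI[OF is_hom_comp[OF is_hom_rename is_hom_rename]])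
     (simp_all add: is_homI rename_mvar rename_mconst assms)

lemma rename_msubst:
  fixes w :: "('v::finite, 'a::comm_ring_1) mpoly" and F :: "'v \<Rightarrow> ('w::finite, 'a) mpoly"
    and e :: "'v \<Rightarrow> 'u::finite"
  assumes "\<And>v. e' (e v) = v"
  shows "rename d (msubst w F) = msubst (rename e w) (\<lambda>u. rename d (F (e' u)))"
  by (rule hom_eqI[OF is_hom_comp[OF is_hom_msubst is_hom_rename] is_hom_comp[OF is_hom_rename is_hom_msubst]])
     (simp_all add: rename_mvar rename_mconst msubst_mvar msubst_mconst assms)

lemma rename_mpderiv:
  fixes p :: "('v::finite, 'a::comm_ring_1) mpoly" and e :: "'v \<Rightarrow> 'u::finite"
  assumes "inj e"
  shows "rename e (mpderiv v p) = mpderiv (e v) (rename e p)"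
proof -
  have "mpderiv (e v) (rename e p) = (\<Sum>i\<in>UNIV. if i = v then rename e (mpderiv v p) else 0)"
    unfolding rename_def mpderiv_msubst
    by (intro sum.cong) (auto simp: mpderiv_mvar dest: injD[OF assms])
  then show ?thesis by simp
qed

lemma rename_det_jacobian:
  fixes F :: "'v::finite \<Rightarrow> ('v, 'a::comm_ring_1) mpoly" and e :: "'v \<Rightarrow> 'u::finite"
  assumes "bij e" "\<And>v. e' (e v) = v"
  shows "rename e (det (jacobian F)) = det (jacobian (\<lambda>u. rename e (F (e' u))))"
proof -
  let ?G = "\<lambda>u. rename e (F (e' u))"
  have "rename e (det (jacobian F)) = det (\<chi> i j. jacobian ?G $ e i $ e j)"
    unfolding hom_det[OF is_hom_rename] by (simp add: rename_mpderiv bij_is_inj assms)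
  also have "\<dots> = det (jacobian ?G)"
    by (rule det_reindex[OF assms(1)])
  finally show ?thesis .
qed

theorem theorem2p1:
  fixes F :: "'v::finite \<Rightarrow> ('v, 'a::field_char_0) mpoly"
    and g :: "('v, 'a) mpoly"
  assumes "squarefree g"
  shows "(g dvd det (jacobian F)
          \<longleftrightarrow> (\<forall>gt. irreducible gt \<and> gt dvd g \<longrightarrow>
                 (\<exists>wt :: ('v, 'a) mpoly. irreducible wt \<and> gt ^ 2 dvd msubst wt F)))
       \<and> (g dvd det (jacobian F)
          \<longleftrightarrow> (\<exists>w :: ('v, 'a) mpoly. squarefree w \<and> g ^ 2 dvd msubst w F))"
proof -
  let ?\<rho> = "rename Abs_ordered_copy :: ('v, 'a) mpoly \<Rightarrow> ('v ordered_copy, 'a) mpoly"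
  let ?\<rho>' = "rename Rep_ordered_copy :: ('v ordered_copy, 'a) mpoly \<Rightarrow> ('v, 'a) mpoly"
  \<comment> \<open>The map \<open>F\<close> with both its components and its variables relabelled
    by the ordered copy.\<close>
  define G where "G u = ?\<rho> (F (Rep_ordered_copy u))" for u
  have \<rho>': "?\<rho>' (?\<rho> p) = p" and \<rho>: "?\<rho> (?\<rho>' q) = q" for p q
    by (simp_all add: rename_inverse Abs_ordered_copy_inverse Rep_ordered_copy_inverse)
  note iso = is_hom_rename is_hom_rename \<rho>' \<rho> and iso' = is_hom_rename is_hom_rename \<rho> \<rho>'
  have det: "?\<rho> (det (jacobian F)) = det (jacobian G)"
    unfolding G_def by (intro rename_det_jacobian bij_Abs_ordered_copy Abs_ordered_copy_inverse) simp
  have msubst: "?\<rho> (msubst w F) = msubst (?\<rho> w) G" for w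
    unfolding G_def by (intro rename_msubst Abs_ordered_copy_inverse) simp
  have irreducible: "irreducible (?\<rho> p) \<longleftrightarrow> irreducible p" for p
    using iso_irreducible[OF iso, of p] iso_irreducible[OF iso', of "?\<rho> p"] by (auto simp: \<rho>')
  have squarefree: "squarefree (?\<rho> p) \<longleftrightarrow> squarefree p" for p
    using iso_squarefree[OF iso, of p] iso_squarefree[OF iso', of "?\<rho> p"] by (auto simp: \<rho>')
  have dvd: "?\<rho> p dvd ?\<rho> q \<longleftrightarrow> p dvd q" for p q
    by (rule iso_dvd_iff[OF iso])
  \<comment> \<open>Surjectivity of the renaming lets quantifiers over the ordered ring range over
    images.\<close>
  have all: "(\<forall>q. P q) \<longleftrightarrow> (\<forall>p. P (?\<rho> p))" and ex: "(\<exists>q. P q) \<longleftrightarrow> (\<exists>p. P (?\<rho> p))" for P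
    using \<rho> by metis+
  have pow: "?\<rho> p ^ 2 = ?\<rho> (p ^ 2)" for p
    by (simp add: hom_power[OF is_hom_rename])
  have 1: "g dvd det (jacobian F) \<longleftrightarrow> ?\<rho> g dvd det (jacobian G)"
    by (simp only: dvd flip: det)
  have 2: "(\<exists>w. irreducible w \<and> p ^ 2 dvd msubst w F) \<longleftrightarrow> (\<exists>w. irreducible w \<and> ?\<rho> p ^ 2 dvd msubst w G)" for p
    unfolding ex by (simp only: irreducible pow dvd flip: msubst)
  have 3: "(\<exists>w. squarefree w \<and> g ^ 2 dvd msubst w F) \<longleftrightarrow> (\<exists>w. squarefree w \<and> ?\<rho> g ^ 2 dvd msubst w G)"
    unfolding ex by (simp only: squarefree pow dvd flip: msubst)
  have 4: "(\<forall>p. irreducible p \<and> p dvd g \<longrightarrow> (\<exists>w :: ('v, 'a) mpoly. irreducible w \<and> p ^ 2 dvd msubst w F)) \<longleftrightarrow>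
      (\<forall>p. irreducible p \<and> p dvd ?\<rho> g \<longrightarrow>
        (\<exists>w :: ('v ordered_copy, 'a) mpoly. irreducible w \<and> p ^ 2 dvd msubst w G))"
    unfolding all by (simp only: irreducible dvd 2)
  have "squarefree (?\<rho> g)"
    using assms by (simp add: squarefree)
  from squarefree_dvd_jacobian_iff[OF this, of G] show ?thesis
    unfolding 1 3 4 .
qed

end
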